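(* Let conditions (Reg1)-(Reg3) (stated in the context) hold, and assume that $p<n$ is fixed. Set $$a_n^1:=\max\{\lambda_n^1 w_1^{(j)}:\ j\le J\},\qquad a_n^0:=\max\{\lambda_n^0 w_0^{(j,rs)}:\ 1\le r<s\le p_j,\ j=1,\dots,J\},$$ and assume $a_n^1/\sqrt n\to_P 0$ and $a_n^0\to_P K$, where $K\in\mathbb R$ is some arbitrary constant. Then there exists an $L_0$-FGL estimator $\hat{\boldsymbol\beta}$ satisfying $$\|\hat{\boldsymbol\beta}-\boldsymbol\beta^*\|_2=O_p\!\left(\frac1{\sqrt n}\right).$$
   Context: Setting: there are $J$ categorical covariates (factors); factor $j$ has $p_j+1$ levels $0,1,\dots,p_j$, level $0$ being the reference category, and $p=\sum_{j=1}^Jp_j$; $J$ and the $p_j$ are fixed. The parameter vector is $\boldsymbol\beta=(\beta_0,\boldsymbol\beta_1,\dots,\boldsymbol\beta_J)\in\mathbb R^{p+1}$ with intercept $\beta_0$, $\boldsymbol\beta_j=(\beta_{j,1},\dots,\beta_{j,p_j})$ and the convention $\beta_{j,0}=0$. Observations $\boldsymbol v_i=(y_i,\boldsymbol x_i)$, $i=1,\dots,n$, are i.i.d. copies of $\boldsymbol v=(y,\boldsymbol x)$ with $y\in\{0,1\}$ and $\boldsymbol x=(1,\boldsymbol x_1,\dots,\boldsymbol x_J)\in\mathbb R^{p+1}$, where $\boldsymbol x_j\in\{0,1\}^{p_j}$ is the dummy coding of factor $j$ (its $k$-th entry is $1$ iff factor $j$ takes level $k$). The data follow the logistic regression model $\mathbb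 E(y\mid\boldsymbol x)=\exp(\boldsymbol x^T\boldsymbol\beta)/(1+\exp(\boldsymbol x^T\boldsymbol\beta))$ with true parameter $\boldsymbol\beta=\boldsymbol\beta^*$ (vectors $\boldsymbol x$ regarded as columns). The log likelihood is $L_n(\boldsymbol\beta)=\sum_{i=1}^n\log f(\boldsymbol v_i,\boldsymbol\beta)$. $L_0$-FGL estimator: a minimizer of $$M_{pen}(\boldsymbol\beta)=-L_n(\boldsymbol\beta)+\lambda_n^1\sum_{j=1}^Jw_1^{(j)}\|\boldsymbol\beta_j\|_2+\lambda_n^0\sum_{j=1}^J\sum_{0\le r<s\le p_j}w_0^{(j,rs)}\|\beta_{j,r}-\beta_{j,s}\|_0,$$ where $\lambda_n^1,\lambda_n^0\ge0$ are tuning parameters, $w_1^{(j)},w_0^{(j,rs)}$ are (possibly data-dependent) positive weights, and $\|t\|_0=0$ if $t=0$, $\|t\|_0=1$ if $t\ne0$ for $t\in\mathbb R$. Regularity conditions. (Reg1) The density can be written as $f(\boldsymbol v,\boldsymbol\beta)=h(y)\exp(y\,\boldsymbol x^T\boldsymbol\beta-\varphi(\boldsymbol x^T\boldsymbol\beta))$; for binary logistic regression $h(y)=1$ and $\varphi(\eta)=\ln(1+\exp(\eta))$. (Reg2) The Fisher information matrix $\boldsymbol I_F(\boldsymbol\beta)$ is finite and positive definite at $\boldsymbol\beta=\boldsymbol\beta^*$, where $\boldsymbol I_F(\boldsymbol\beta^* )=\mathbb E(\varphi''(\boldsymbol x^T\boldsymbol\beta^* )\boldsymbol x\boldsymbol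 x^T)$. (Reg3) There is an open set $\mathcal O$ (depending on $n$) with $\boldsymbol\beta^*\in\mathcal O$ and a function $M(\boldsymbol x)\in\mathbb R$ such that for all $\boldsymbol\beta\in\mathcal O$: $|\varphi'''(\boldsymbol x^T\boldsymbol\beta)|\le M(\boldsymbol x)<\infty$, and $\mathbb E(M(\boldsymbol x)|x_jx_kx_l|)<\infty$ for all $1\le j,k,l\le p$. $\to_P$ denotes convergence in probability as $n\to\infty$.
   Formalization: The maximum a_n^0 is taken over 0 ≤ r < s ≤ p_j (including the reference level, as in the penalty), since otherwise the claim fails; and the estimator is a global minimizer with probability tending to 1, as a minimizer need not exist for every sample. *)

theory Defs
  imports "HOL-Probability.Probability"
begin

text \<open>
  Vectors of \<open>p + 1\<close> coordinates live in \<open>real ^ 'd option\<close>: the index \<open>None\<close> is the intercept, and the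
  finite type \<open>'d\<close> is enumerated by a bijection \<open>ix\<close> from the pairs (factor \<open>j\<close>, level \<open>k\<close>) with
  \<open>1 \<le> j \<le> J\<close> and \<open>1 \<le> k \<le> p j\<close>. Hence \<open>CARD('d) = (\<Sum>j=1..J. p j)\<close>.
  An observation is a pair \<open>v = (y, x)\<close>; the observations are numbered from 0.
\<close>

definition dummy_index :: "nat \<Rightarrow> (nat \<Rightarrow> nat) \<Rightarrow> (nat \<times> nat) set" where
  "dummy_index J p = (SIGMA j:{1..J}. {1..p j})"

text \<open>Here \<open>c j\<close> is the level taken by factor \<open>j\<close>.\<close>

definition design_vectors ::
  "nat \<Rightarrow> (nat \<Rightarrow> nat) \<Rightarrow> (nat \<times> nat \<Rightarrow> 'd::finite) \<Rightarrow> (real ^ 'd option) set" where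
  "design_vectors J p ix =
     {x. x $ None = 1 \<and>
         (\<exists>c. \<forall>j\<in>{1..J}. c j \<le> p j \<and>
              (\<forall>k\<in>{1..p j}. x $ Some (ix (j, k)) = of_bool (c j = k)))}"

definition coef :: "(nat \<times> nat \<Rightarrow> 'd::finite) \<Rightarrow> real ^ 'd option \<Rightarrow> nat \<Rightarrow> nat \<Rightarrow> real" where
  "coef ix \<beta> j k = (if k = 0 then 0 else \<beta> $ Some (ix (j, k)))"

section \<open>Logistic regression\<close>

definition logistic_model ::
  "(real \<times> (real ^ 'i::finite)) measure \<Rightarrow> real ^ 'i \<Rightarrow> bool" where
  "logistic_model D \<beta> \<longleftrightarrow>
     (AE v in D. real_cond_exp D (vimage_algebra (space D) snd borel) fst v
                 = exp (snd v \<bullet> \<beta>) / (1 + exp (snd v \<bullet> \<beta>)))"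

text \<open>The conditional (Bernoulli) density of \<open>y\<close> given \<open>x\<close>; only \<open>y = 0\<close> and \<open>y = 1\<close> matter.\<close>

definition logistic_density :: "real \<times> (real ^ 'i::finite) \<Rightarrow> real ^ 'i \<Rightarrow> real" where
  "logistic_density v \<beta> =
     (let q = exp (snd v \<bullet> \<beta>) / (1 + exp (snd v \<bullet> \<beta>)) in if fst v = 1 then q else 1 - q)"

definition log_likelihood ::
  "(real \<times> (real ^ 'i::finite) \<Rightarrow> real ^ 'i \<Rightarrow> real) \<Rightarrow> nat \<Rightarrow> (nat \<Rightarrow> real \<times> (real ^ 'i))
     \<Rightarrow> real ^ 'i \<Rightarrow> real" where
  "log_likelihood f n v \<beta> = (\<Sum>i<n. ln (f (v i) \<beta>))"

definition logistic_cumulant :: "real \<Rightarrow> real" where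
  "logistic_cumulant \<eta> = ln (1 + exp \<eta>)"

section \<open>Regularity conditions\<close>

definition Reg1 ::
  "(real \<times> (real ^ 'i::finite) \<Rightarrow> real ^ 'i \<Rightarrow> real) \<Rightarrow> (real \<Rightarrow> real) \<Rightarrow> (real \<Rightarrow> real) \<Rightarrow> bool" where
  "Reg1 f h \<phi> \<longleftrightarrow>
     (\<forall>y\<in>{0, 1}. \<forall>x \<beta>. f (y, x) \<beta> = h y * exp (y * (x \<bullet> \<beta>) - \<phi> (x \<bullet> \<beta>)))"

definition fisher_information ::
  "(real \<times> (real ^ 'i::finite)) measure \<Rightarrow> (real \<Rightarrow> real) \<Rightarrow> real ^ 'i \<Rightarrow> real ^ 'i ^ 'i" where
  "fisher_information D \<phi> \<beta> =
     (\<chi> k l. \<integral>v. (deriv ^^ 2) \<phi> (snd v \<bullet> \<beta>) * (snd v $ k * snd v $ l) \<partial>D)"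

definition positive_definite :: "real ^ 'i ^ 'i::finite \<Rightarrow> bool" where
  "positive_definite A \<longleftrightarrow> transpose A = A \<and> (\<forall>u. u \<noteq> 0 \<longrightarrow> 0 < u \<bullet> (A *v u))"

text \<open>The integrability clause says that the matrix is finite; without it the Bochner integrals in
  \<open>fisher_information\<close> would silently be 0.\<close>

definition Reg2 ::
  "(real \<times> (real ^ 'i::finite)) measure \<Rightarrow> (real \<Rightarrow> real) \<Rightarrow> real ^ 'i \<Rightarrow> bool" where
  "Reg2 D \<phi> \<beta> \<longleftrightarrow>
     (\<forall>k l. integrable D (\<lambda>v. (deriv ^^ 2) \<phi> (snd v \<bullet> \<beta>) * (snd v $ k * snd v $ l))) \<and>
     positive_definite (fisher_information D \<phi> \<beta>)"

definition Reg3 ::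
  "(real \<times> (real ^ 'd::finite option)) measure \<Rightarrow> (real \<Rightarrow> real) \<Rightarrow> real ^ 'd option \<Rightarrow> bool" where
  "Reg3 D \<phi> \<beta>0 \<longleftrightarrow>
     (\<exists>(U :: nat \<Rightarrow> (real ^ 'd option) set) (B :: real ^ 'd option \<Rightarrow> real).
        (\<forall>n. open (U n) \<and> \<beta>0 \<in> U n \<and>
             (AE v in D. \<forall>\<beta>\<in>U n. \<bar>(deriv ^^ 3) \<phi> (snd v \<bullet> \<beta>)\<bar> \<le> B (snd v))) \<and>
        (\<forall>j k l :: 'd. integrable D
             (\<lambda>v. B (snd v) * \<bar>snd v $ Some j * snd v $ Some k * snd v $ Some l\<bar>)))"

section \<open>The estimator\<close>

definition l0_norm :: "real \<Rightarrow> real" where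
  "l0_norm t = (if t = 0 then 0 else 1)"

definition M_pen ::
  "nat \<Rightarrow> (nat \<Rightarrow> nat) \<Rightarrow> (nat \<times> nat \<Rightarrow> 'd::finite) \<Rightarrow> nat \<Rightarrow> (nat \<Rightarrow> real \<times> (real ^ 'd option))
     \<Rightarrow> real \<Rightarrow> (nat \<Rightarrow> real) \<Rightarrow> real \<Rightarrow> (nat \<Rightarrow> nat \<Rightarrow> nat \<Rightarrow> real) \<Rightarrow> real ^ 'd option \<Rightarrow> real" where
  "M_pen J p ix n v lam1 w1 lam0 w0 \<beta> =
     - log_likelihood logistic_density n v \<beta>
     + lam1 * (\<Sum>j=1..J. w1 j * L2_set (coef ix \<beta> j) {1..p j})
     + lam0 * (\<Sum>j=1..J. \<Sum>(r, s)\<in>{(r, s). r < s \<and> s \<le> p j}.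
               w0 j r s * l0_norm (coef ix \<beta> j r - coef ix \<beta> j s))"

definition L0_FGL_estimator ::
  "nat \<Rightarrow> (nat \<Rightarrow> nat) \<Rightarrow> (nat \<times> nat \<Rightarrow> 'd::finite) \<Rightarrow> nat \<Rightarrow> (nat \<Rightarrow> real \<times> (real ^ 'd option))
     \<Rightarrow> real \<Rightarrow> (nat \<Rightarrow> real) \<Rightarrow> real \<Rightarrow> (nat \<Rightarrow> nat \<Rightarrow> nat \<Rightarrow> real) \<Rightarrow> real ^ 'd option \<Rightarrow> bool" where
  "L0_FGL_estimator J p ix n v lam1 w1 lam0 w0 \<beta> \<longleftrightarrow>
     is_arg_min (M_pen J p ix n v lam1 w1 lam0 w0) (\<lambda>_. True) \<beta>"

definition max_group_weight :: "nat \<Rightarrow> real \<Rightarrow> (nat \<Rightarrow> real) \<Rightarrow> real" where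
  "max_group_weight J lam1 w1 = Max {lam1 * w1 j | j. j \<in> {1..J}}"

text \<open>The pairs \<open>(r, s)\<close> are those of the \<open>L\<^sub>0\<close> penalty and so include the reference level \<open>r = 0\<close>: if
  the weights for \<open>r = 0\<close> were left unconstrained, they could force nonzero coefficients of the
  minimizer to 0.\<close>

definition max_fusion_weight ::
  "nat \<Rightarrow> (nat \<Rightarrow> nat) \<Rightarrow> real \<Rightarrow> (nat \<Rightarrow> nat \<Rightarrow> nat \<Rightarrow> real) \<Rightarrow> real" where
  "max_fusion_weight J p lam0 w0 = Max {lam0 * w0 j r s | j r s. j \<in> {1..J} \<and> r < s \<and> s \<le> p j}"

section \<open>Stochastic convergence\<close>

definition tendsto_in_prob :: "'a measure \<Rightarrow> (nat \<Rightarrow> 'a \<Rightarrow> real) \<Rightarrow> real \<Rightarrow> bool" where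
  "tendsto_in_prob \<Omega> Z c \<longleftrightarrow>
     (\<forall>\<epsilon>>0. (\<lambda>n. measure \<Omega> {\<omega>\<in>space \<Omega>. \<bar>Z n \<omega> - c\<bar> > \<epsilon>}) \<longlonglongrightarrow> 0)"

definition bigO_in_prob :: "'a measure \<Rightarrow> (nat \<Rightarrow> 'a \<Rightarrow> real) \<Rightarrow> (nat \<Rightarrow> real) \<Rightarrow> bool" where
  "bigO_in_prob \<Omega> Z r \<longleftrightarrow>
     (\<forall>\<epsilon>>0. \<exists>C>0. \<exists>N. \<forall>n\<ge>N. measure \<Omega> {\<omega>\<in>space \<Omega>. \<bar>Z n \<omega>\<bar> > C * r n} < \<epsilon>)"

end

theory Submission
  imports Defs "HOL-Real_Asymp.Real_Asymp"
begin

text \<open>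
  The rate comes from a comparison of orders of magnitude on the sphere of radius \<open>C / sqrt n\<close> around
  the true parameter. There, with probability close to 1, the negative log likelihood exceeds its value
  at the centre by at least \<open>c * C\<^sup>2 - T * C\<close>. The quadratic term is the curvature: the empirical information matrix
  is close to \<open>n\<close> times the Fisher information, which is positive definite. The linear term is the
  score, a sum of \<open>n\<close> independent bounded variables whose mean is 0 by the logistic model, hence of
  order \<open>sqrt n\<close>. Both facts follow from Hoeffding's inequality, because dummy-coded covariates are
  bounded (\<open>log_likelihood_quadratic_drop\<close>).

  The penalties cannot compensate for this. The group penalty is Lipschitz with a constant of order
  \<open>a\<^sup>1 = o(sqrt n)\<close>, so on the sphere it moves by at most a multiple of \<open>C\<close>. The \<open>L\<^sub>0\<close> penalty is
  discontinuous and not convex, but it is nonnegative, and at the true parameter it is at most the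
  number of level pairs times \<open>a\<^sup>0\<close>, that is, bounded. For large \<open>C\<close> the quadratic term wins on the
  sphere. Outside the sphere the likelihood gap grows at least linearly, by convexity, and so does the
  bound for the group penalty, while the bound for the \<open>L\<^sub>0\<close> penalty stays constant. Therefore every
  point on or outside the sphere is beaten by the true parameter itself (\<open>M_pen_separation\<close>), and
  every global minimizer lies in the ball.

  It remains to produce a minimizer that is a random vector. The estimator is taken to minimize the
  criterion over the fixed unit ball around the true parameter; by the separation this is a
  global minimizer with probability tending to 1. Since the criterion is not continuous, it is
  written as the minimum of finitely many continuous criteria, one for each pattern of fused levels,
  each restricted to the subspace on which these levels have equal coefficients. On every such piece
  a measurable minimizer exists (\<open>measurable_minimizer\<close>), and the best of these finitely many
  candidates is again measurable (\<open>measurable_piecewise_minimizer\<close>). The same decomposition reduces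
  global minimality to countably many comparisons, so that it is an event
  (\<open>sets_global_minimizer\<close>).
\<close>

section \<open>Measurable selection of minimizers\<close>

text \<open>
  Membership of a minimizer in \<open>C\<close> can be tested on countable dense subsets: it means that \<open>C\<close> contains
  approximate minimizers to every precision \<open>1 / Suc m\<close>. Compactness of \<open>C\<close> supplies the converse, since
  the minimum over \<open>C\<close> is attained and is then at most every value on \<open>K\<close>.
\<close>

lemma sets_minimizer_in_compact:
  fixes f :: "'a \<Rightarrow> 'b::{metric_space, second_countable_topology} \<Rightarrow> real"
  assumes meas: "\<And>x. x \<in> K \<Longrightarrow> (\<lambda>\<omega>. f \<omega> x) \<in> borel_measurable M"
    and cont: "\<And>\<omega>. \<omega> \<in> space M \<Longrightarrow> continuous_on K (f \<omega>)"
    and C: "compact C" "C \<subseteq> K"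
  shows "{\<omega> \<in> space M. \<exists>x\<in>C. \<forall>y\<in>K. f \<omega> x \<le> f \<omega> y} \<in> sets M"
proof -
  obtain DC where DC: "countable DC" "DC \<subseteq> C" "C \<subseteq> closure DC"
    using separable by blast
  obtain DK where DK: "countable DK" "DK \<subseteq> K" "K \<subseteq> closure DK"
    using separable by blast
  have "(\<exists>x\<in>C. \<forall>y\<in>K. f \<omega> x \<le> f \<omega> y) \<longleftrightarrow>
        (\<forall>m::nat. \<exists>c\<in>DC. \<forall>q\<in>DK. f \<omega> c \<le> f \<omega> q + 1 / Suc m)"
    if \<omega>: "\<omega> \<in> space M" for \<omega>
  proof
    assume "\<exists>x\<in>C. \<forall>y\<in>K. f \<omega> x \<le> f \<omega> y"
    then obtain x where x: "x \<in> C" "\<And>y. y \<in> K \<Longrightarrow> f \<omega> x \<le> f \<omega> y" by blast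
    have cC: "continuous_on C (f \<omega>)"
      using cont[OF \<omega>] C(2) continuous_on_subset by blast
    show "\<forall>m::nat. \<exists>c\<in>DC. \<forall>q\<in>DK. f \<omega> c \<le> f \<omega> q + 1 / Suc m"
    proof
      fix m :: nat
      obtain d where d: "d > 0" "\<And>z. z \<in> C \<Longrightarrow> dist z x < d \<Longrightarrow> dist (f \<omega> z) (f \<omega> x) < 1 / Suc m"
        using cC[unfolded continuous_on_iff, rule_format, OF x(1), of "1 / Suc m"] by auto
      obtain c where c: "c \<in> DC" "dist c x < d"
        using DC(3) x(1) d(1) closure_approachable by blast
      have "f \<omega> c \<le> f \<omega> x + 1 / Suc m"
        using d(2)[of c] c DC(2) by (auto simp: dist_real_def)
      then show "\<exists>c\<in>DC. \<forall>q\<in>DK. f \<omega> c \<le> f \<omega> q + 1 / Suc m"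
        using c(1) x(2) DK(2) by (meson add_right_mono order_trans subsetD)
    qed
  next
    assume R: "\<forall>m::nat. \<exists>c\<in>DC. \<forall>q\<in>DK. f \<omega> c \<le> f \<omega> q + 1 / Suc m"
    then have "C \<noteq> {}" using DC(2) by blast
    moreover have "continuous_on C (f \<omega>)"
      using cont[OF \<omega>] C(2) continuous_on_subset by blast
    ultimately obtain x where x: "x \<in> C" "\<And>z. z \<in> C \<Longrightarrow> f \<omega> x \<le> f \<omega> z"
      using continuous_attains_inf[OF C(1)] by blast
    have le: "f \<omega> x \<le> f \<omega> q" if q: "q \<in> DK" for q
    proof (rule field_le_epsilon)
      fix e :: real assume "0 < e"
      then obtain m :: nat where m: "1 / Suc m < e"
        using nat_approx_posE by blast
      obtain c where "c \<in> DC" "f \<omega> c \<le> f \<omega> q + 1 / Suc m" using R q by blast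
      then show "f \<omega> x \<le> f \<omega> q + e" using x(2)[of c] DC(2) m by (smt (verit) subsetD)
    qed
    have "f \<omega> x \<le> f \<omega> y" if y: "y \<in> K" for y
    proof (rule ccontr)
      assume "\<not> f \<omega> x \<le> f \<omega> y"
      then have "f \<omega> x - f \<omega> y > 0" by simp
      then obtain d where d: "d > 0" "\<And>z. z \<in> K \<Longrightarrow> dist z y < d \<Longrightarrow> dist (f \<omega> z) (f \<omega> y) < f \<omega> x - f \<omega> y"
        using cont[OF \<omega>, unfolded continuous_on_iff, rule_format, OF y] by blast
      obtain q where "q \<in> DK" "dist q y < d"
        using DK(3) y d(1) closure_approachable by blast
      with d(2)[of q] DK(2) le[of q] show False by (force simp: dist_real_def)
    qed
    with x(1) show "\<exists>x\<in>C. \<forall>y\<in>K. f \<omega> x \<le> f \<omega> y" by blast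
  qed
  then have "{\<omega> \<in> space M. \<exists>x\<in>C. \<forall>y\<in>K. f \<omega> x \<le> f \<omega> y} =
     {\<omega> \<in> space M. \<forall>m::nat. \<exists>c\<in>DC. \<forall>q\<in>DK. f \<omega> c \<le> f \<omega> q + 1 / Suc m}"
    by blast
  also have "\<dots> \<in> sets M"
  proof -
    have m: "(\<lambda>\<omega>. f \<omega> x) \<in> borel_measurable M" if "x \<in> DC \<or> x \<in> DK" for x
      using that meas DC(2) DK(2) C(2) by blast
    have "Measurable.pred M (\<lambda>\<omega>. f \<omega> c \<le> f \<omega> q + 1 / Suc m)" if "c \<in> DC" "q \<in> DK" for c q m
      unfolding pred_def using that m by (intro borel_measurable_le borel_measurable_add) auto
    then have "Measurable.pred M (\<lambda>\<omega>. \<forall>m::nat. \<exists>c\<in>DC. \<forall>q\<in>DK. f \<omega> c \<le> f \<omega> q + 1 / Suc m)"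
      using DC(1) DK(1) by (intro pred_intros_countable pred_intros_countable_bounded) auto
    then show ?thesis by (simp add: pred_def)
  qed
  finally show ?thesis .
qed

text \<open>
  The minimizer is chosen lexicographically. If \<open>t i \<omega>\<close> is the smallest \<open>i\<close>-th coordinate among the
  minimizers of \<open>f \<omega>\<close>, then \<open>t i\<close> is measurable because \<open>t i \<omega> \<le> c\<close> says that a halfspace contains a
  minimizer. Adding \<open>\<bar>x \<bullet> i - t i \<omega>\<bar>\<close> to the function preserves the minimal value and keeps exactly the
  minimizers with this coordinate. After all coordinates have been treated, a single point remains, and
  its coordinates are measurable.
\<close>

lemma measurable_minimizer:
  fixes f :: "'a \<Rightarrow> 'b::euclidean_space \<Rightarrow> real"
  assumes K: "compact K" "K \<noteq> {}"
    and meas: "\<And>x. x \<in> K \<Longrightarrow> (\<lambda>\<omega>. f \<omega> x) \<in> borel_measurable M"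
    and cont: "\<And>\<omega>. \<omega> \<in> space M \<Longrightarrow> continuous_on K (f \<omega>)"
  obtains b where "b \<in> borel_measurable M"
    "\<And>\<omega>. \<omega> \<in> space M \<Longrightarrow> b \<omega> \<in> K \<and> (\<forall>y\<in>K. f \<omega> (b \<omega>) \<le> f \<omega> y)"
proof -
  define argmin where "argmin g \<omega> = {x \<in> K. \<forall>y\<in>K. g \<omega> x \<le> g \<omega> y}" for g :: "'a \<Rightarrow> 'b \<Rightarrow> real" and \<omega>
  have argmin_ne: "argmin g \<omega> \<noteq> {}" if "continuous_on K (g \<omega>)" for g \<omega>
    using continuous_attains_inf[OF K that] by (auto simp: argmin_def)
  have compact_argmin: "compact (argmin g \<omega>)" if g: "continuous_on K (g \<omega>)" for g \<omega>
  proof -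
    obtain x where x: "x \<in> K" "\<forall>y\<in>K. g \<omega> x \<le> g \<omega> y" using continuous_attains_inf[OF K g] by blast
    then have "argmin g \<omega> = K \<inter> g \<omega> -` {..g \<omega> x}" unfolding argmin_def by (auto intro: order_trans)
    moreover have "closed (K \<inter> g \<omega> -` {..g \<omega> x})"
      using g K(1) by (intro continuous_closed_preimage) (auto intro: compact_imp_closed)
    ultimately show ?thesis using K(1) by (metis Int_absorb1 compact_Int_closed inf_le1)
  qed
  have "\<exists>g t. (\<forall>x\<in>K. (\<lambda>\<omega>. g \<omega> x) \<in> borel_measurable M) \<and>
          (\<forall>\<omega>\<in>space M. continuous_on K (g \<omega>) \<and> argmin g \<omega> \<subseteq> argmin f \<omega> \<and>
              (\<forall>x\<in>argmin g \<omega>. \<forall>i\<in>B. x \<bullet> i = t i \<omega>)) \<and>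
          (\<forall>i\<in>B. t i \<in> borel_measurable M)"
    if "finite B" "B \<subseteq> Basis" for B :: "'b set"
    using that
  proof (induction B rule: finite_induct)
    case empty
    show ?case by (rule exI[of _ f]) (use meas cont in auto)
  next
    case (insert i B)
    from insert.IH insert.prems obtain g t where
      gm: "\<forall>x\<in>K. (\<lambda>\<omega>. g \<omega> x) \<in> borel_measurable M"
      and g: "\<forall>\<omega>\<in>space M. continuous_on K (g \<omega>) \<and> argmin g \<omega> \<subseteq> argmin f \<omega> \<and>
              (\<forall>x\<in>argmin g \<omega>. \<forall>i\<in>B. x \<bullet> i = t i \<omega>)"
      and tm: "\<forall>j\<in>B. t j \<in> borel_measurable M"
      by auto
    have gc: "continuous_on K (g \<omega>)" and ga: "argmin g \<omega> \<subseteq> argmin f \<omega>"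
      and gt: "\<And>x j. x \<in> argmin g \<omega> \<Longrightarrow> j \<in> B \<Longrightarrow> x \<bullet> j = t j \<omega>"
      if "\<omega> \<in> space M" for \<omega> using g that by blast+
    have "\<exists>x\<in>argmin g \<omega>. \<forall>y\<in>argmin g \<omega>. x \<bullet> i \<le> y \<bullet> i" if "\<omega> \<in> space M" for \<omega>
      using gc[OF that]
      by (intro continuous_attains_inf compact_argmin argmin_ne continuous_intros)
    then obtain a where a: "\<And>\<omega>. \<omega> \<in> space M \<Longrightarrow> a \<omega> \<in> argmin g \<omega>"
        "\<And>\<omega> y. \<omega> \<in> space M \<Longrightarrow> y \<in> argmin g \<omega> \<Longrightarrow> a \<omega> \<bullet> i \<le> y \<bullet> i" by metis
    define s where "s \<omega> = a \<omega> \<bullet> i" for \<omega>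
    have s: "s \<in> borel_measurable M"
    proof (rule borel_measurableI_le)
      fix c
      have "{\<omega> \<in> space M. s \<omega> \<le> c} =
            {\<omega> \<in> space M. \<exists>x\<in>K \<inter> {x. i \<bullet> x \<le> c}. \<forall>y\<in>K. g \<omega> x \<le> g \<omega> y}"
      proof -
        have "s \<omega> \<le> c \<longleftrightarrow> (\<exists>x\<in>K \<inter> {x. i \<bullet> x \<le> c}. \<forall>y\<in>K. g \<omega> x \<le> g \<omega> y)" if \<omega>: "\<omega> \<in> space M" for \<omega>
        proof
          assume "s \<omega> \<le> c"
          then show "\<exists>x\<in>K \<inter> {x. i \<bullet> x \<le> c}. \<forall>y\<in>K. g \<omega> x \<le> g \<omega> y"
            using a(1)[OF \<omega>] by (intro bexI[of _ "a \<omega>"]) (auto simp: s_def argmin_def inner_commute)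
        next
          assume "\<exists>x\<in>K \<inter> {x. i \<bullet> x \<le> c}. \<forall>y\<in>K. g \<omega> x \<le> g \<omega> y"
          then obtain x where "x \<in> argmin g \<omega>" "x \<bullet> i \<le> c" by (auto simp: argmin_def inner_commute)
          then show "s \<omega> \<le> c" using a(2)[OF \<omega>] unfolding s_def by (meson order_trans)
        qed
        then show ?thesis by blast
      qed
      also have "\<dots> \<in> sets M"
        by (rule sets_minimizer_in_compact)
           (auto simp: gm gc intro!: compact_Int_closed K closed_halfspace_le)
      finally show "{\<omega> \<in> space M. s \<omega> \<le> c} \<in> sets M" .
    qed
    \<comment> \<open>The added term vanishes at the minimizer \<open>a \<omega>\<close> of \<open>g \<omega>\<close>, hence the minimum is unchanged and
      every minimizer of the sum minimizes both summands.\<close>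
    define g' where "g' \<omega> x = g \<omega> x + \<bar>x \<bullet> i - s \<omega>\<bar>" for \<omega> x
    have sub: "x \<in> argmin g \<omega> \<and> x \<bullet> i = s \<omega>" if \<omega>: "\<omega> \<in> space M" and x: "x \<in> argmin g' \<omega>" for x \<omega>
    proof -
      have "g \<omega> x + \<bar>x \<bullet> i - s \<omega>\<bar> \<le> g \<omega> (a \<omega>)"
        using x a(1)[OF \<omega>] unfolding argmin_def g'_def s_def by force
      moreover have "g \<omega> (a \<omega>) \<le> g \<omega> y" if "y \<in> K" for y
        using a(1)[OF \<omega>] that by (auto simp: argmin_def)
      ultimately show ?thesis using x unfolding argmin_def by (smt (verit) mem_Collect_eq)
    qed
    show ?case
    proof (intro exI conjI ballI)
      show "(\<lambda>\<omega>. g' \<omega> x) \<in> borel_measurable M" if "x \<in> K" for x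
        unfolding g'_def using gm that s by (intro borel_measurable_add borel_measurable_abs borel_measurable_diff) auto
      show "continuous_on K (g' \<omega>)" if "\<omega> \<in> space M" for \<omega>
        unfolding g'_def using gc[OF that] by (intro continuous_intros)
      show "argmin g' \<omega> \<subseteq> argmin f \<omega>" if "\<omega> \<in> space M" for \<omega>
        using sub[OF that] ga[OF that] by blast
      show "x \<bullet> j = (t(i := s)) j \<omega>" if "\<omega> \<in> space M" "x \<in> argmin g' \<omega>" "j \<in> insert i B" for \<omega> x j
        using sub[OF that(1,2)] gt[OF that(1)] that(3) by auto
      show "(t(i := s)) j \<in> borel_measurable M" if "j \<in> insert i B" for j
        using that tm s by auto
    qed
  qed
  from this[of Basis] obtain g t where
      g: "\<forall>\<omega>\<in>space M. continuous_on K (g \<omega>) \<and> argmin g \<omega> \<subseteq> argmin f \<omega> \<and>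
              (\<forall>x\<in>argmin g \<omega>. \<forall>i\<in>Basis. x \<bullet> i = t i \<omega>)"
      and tm: "\<forall>j\<in>Basis. t j \<in> borel_measurable M"
    by auto
  have gc: "continuous_on K (g \<omega>)" and ga: "argmin g \<omega> \<subseteq> argmin f \<omega>"
    and gt: "\<And>x j. x \<in> argmin g \<omega> \<Longrightarrow> j \<in> Basis \<Longrightarrow> x \<bullet> j = t j \<omega>"
    if "\<omega> \<in> space M" for \<omega> using g that by blast+
  define b where "b \<omega> = (\<Sum>j\<in>Basis. t j \<omega> *\<^sub>R j)" for \<omega>
  have "b \<omega> \<in> argmin f \<omega>" if \<omega>: "\<omega> \<in> space M" for \<omega>
  proof -
    obtain x where x: "x \<in> argmin g \<omega>" using argmin_ne[of g, OF gc[OF \<omega>]] by blast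
    then have "b \<omega> = (\<Sum>j\<in>Basis. (x \<bullet> j) *\<^sub>R j)"
      unfolding b_def using gt[OF \<omega> x] by (intro sum.cong) auto
    then have "b \<omega> = x" by (simp add: euclidean_representation)
    then show ?thesis using ga[OF \<omega>] x by blast
  qed
  moreover have "b \<in> borel_measurable M"
    unfolding b_def using tm by (intro borel_measurable_sum borel_measurable_scaleR) auto
  ultimately show thesis by (intro that[of b]) (auto simp: argmin_def)
qed

text \<open>
  Here \<open>F \<omega>\<close> is the pointwise minimum of the continuous functions \<open>f i \<omega>\<close>, each used only on \<open>S i\<close>. A
  value is a lower bound of \<open>F \<omega>\<close> if it is one of every piece, and by continuity it suffices to
  compare on a countable dense subset of each \<open>S i\<close>. A dense subset of the whole space would not do,
  because \<open>S i\<close> may have empty interior.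
\<close>

lemma sets_global_minimizer:
  fixes f :: "'i \<Rightarrow> 'a \<Rightarrow> 'b::{metric_space, second_countable_topology} \<Rightarrow> real"
    and F :: "'a \<Rightarrow> 'b \<Rightarrow> real"
  assumes I: "finite I"
    and meas: "\<And>i x. i \<in> I \<Longrightarrow> (\<lambda>\<omega>. f i \<omega> x) \<in> borel_measurable M"
    and cont: "\<And>i \<omega>. i \<in> I \<Longrightarrow> \<omega> \<in> space M \<Longrightarrow> continuous_on UNIV (f i \<omega>)"
    and le: "\<And>i \<omega> x. i \<in> I \<Longrightarrow> \<omega> \<in> space M \<Longrightarrow> x \<in> S i \<Longrightarrow> F \<omega> x \<le> f i \<omega> x"
    and att: "\<And>\<omega> x. \<omega> \<in> space M \<Longrightarrow> \<exists>i\<in>I. x \<in> S i \<and> F \<omega> x = f i \<omega> x"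
    and b: "(\<lambda>\<omega>. F \<omega> (b \<omega>)) \<in> borel_measurable M"
  shows "{\<omega> \<in> space M. \<forall>x. F \<omega> (b \<omega>) \<le> F \<omega> x} \<in> sets M"
proof -
  have "\<exists>T. countable T \<and> T \<subseteq> S i \<and> S i \<subseteq> closure T" for i
    by (meson separable)
  then obtain Q where Q: "\<And>i. countable (Q i)" "\<And>i. Q i \<subseteq> S i" "\<And>i. S i \<subseteq> closure (Q i)"
    by metis
  have "(\<forall>x. F \<omega> (b \<omega>) \<le> F \<omega> x) \<longleftrightarrow> (\<forall>i\<in>I. \<forall>q\<in>Q i. F \<omega> (b \<omega>) \<le> f i \<omega> q)"
    if \<omega>: "\<omega> \<in> space M" for \<omega>
  proof
    assume "\<forall>x. F \<omega> (b \<omega>) \<le> F \<omega> x"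
    then show "\<forall>i\<in>I. \<forall>q\<in>Q i. F \<omega> (b \<omega>) \<le> f i \<omega> q"
      using le[OF _ \<omega>] Q(2) by (meson order_trans subsetD)
  next
    assume R: "\<forall>i\<in>I. \<forall>q\<in>Q i. F \<omega> (b \<omega>) \<le> f i \<omega> q"
    show "\<forall>x. F \<omega> (b \<omega>) \<le> F \<omega> x"
    proof
      fix x
      obtain i where i: "i \<in> I" "x \<in> S i" "F \<omega> x = f i \<omega> x" using att[OF \<omega>] by blast
      have "continuous_on (closure (Q i)) (f i \<omega>)"
        using cont[OF i(1) \<omega>] continuous_on_subset by blast
      then have "F \<omega> (b \<omega>) \<le> f i \<omega> x"
        by (rule continuous_ge_on_closure) (use R i Q(3) in auto)
      then show "F \<omega> (b \<omega>) \<le> F \<omega> x" using i(3) by simp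
    qed
  qed
  then have "{\<omega> \<in> space M. \<forall>x. F \<omega> (b \<omega>) \<le> F \<omega> x} =
      {\<omega> \<in> space M. \<forall>i\<in>I. \<forall>q\<in>Q i. F \<omega> (b \<omega>) \<le> f i \<omega> q}" by blast
  also have "\<dots> \<in> sets M"
    using Q(1) I b meas
    by (intro sets.sets_Collect_finite_All sets.sets_Collect_countable_All' borel_measurable_le) auto
  finally show ?thesis .
qed

text \<open>
  A measurable minimizer is available on each piece; the induction over the pieces keeps the better of
  two candidates. They are compared by their values of \<open>F\<close>, which may be smaller than those of the piece
  that a candidate came from.
\<close>

lemma measurable_piecewise_minimizer:
  fixes f :: "'i \<Rightarrow> 'a \<Rightarrow> 'b::euclidean_space \<Rightarrow> real" and F :: "'a \<Rightarrow> 'b \<Rightarrow> real"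
  assumes I: "finite I" and S: "\<And>i. i \<in> I \<Longrightarrow> closed (S i)"
    and K: "compact K" "K \<noteq> {}"
    and meas: "\<And>i x. i \<in> I \<Longrightarrow> (\<lambda>\<omega>. f i \<omega> x) \<in> borel_measurable M"
    and cont: "\<And>i \<omega>. i \<in> I \<Longrightarrow> \<omega> \<in> space M \<Longrightarrow> continuous_on UNIV (f i \<omega>)"
    and le: "\<And>i \<omega> x. i \<in> I \<Longrightarrow> \<omega> \<in> space M \<Longrightarrow> x \<in> S i \<Longrightarrow> F \<omega> x \<le> f i \<omega> x"
    and att: "\<And>\<omega> x. \<omega> \<in> space M \<Longrightarrow> \<exists>i\<in>I. x \<in> S i \<and> F \<omega> x = f i \<omega> x"
    and comp: "\<And>b. b \<in> borel_measurable M \<Longrightarrow> (\<lambda>\<omega>. F \<omega> (b \<omega>)) \<in> borel_measurable M"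
  obtains b where "b \<in> borel_measurable M"
    "\<And>\<omega>. \<omega> \<in> space M \<Longrightarrow> b \<omega> \<in> K \<and> (\<forall>y\<in>K. F \<omega> (b \<omega>) \<le> F \<omega> y)"
proof -
  have "\<exists>b. b \<in> borel_measurable M \<and>
     (\<forall>\<omega>\<in>space M. b \<omega> \<in> K \<and> (\<forall>i\<in>I'. \<forall>y\<in>S i \<inter> K. F \<omega> (b \<omega>) \<le> f i \<omega> y))"
    if "finite I'" "I' \<subseteq> I" for I'
    using that
  proof (induction I' rule: finite_induct)
    case empty
    obtain k where "k \<in> K" using K(2) by blast
    then show ?case by (intro exI[of _ "\<lambda>_. k"]) auto
  next
    case (insert i I')
    then obtain b where b: "b \<in> borel_measurable M"
      "\<forall>\<omega>\<in>space M. b \<omega> \<in> K \<and> (\<forall>i\<in>I'. \<forall>y\<in>S i \<inter> K. F \<omega> (b \<omega>) \<le> f i \<omega> y)" by auto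
    have i: "i \<in> I" using insert by simp
    show ?case
    proof (cases "S i \<inter> K = {}")
      case True
      with b show ?thesis by (intro exI[of _ b]) auto
    next
      case False
      obtain c where c: "c \<in> borel_measurable M"
        "\<And>\<omega>. \<omega> \<in> space M \<Longrightarrow> c \<omega> \<in> S i \<inter> K \<and> (\<forall>y\<in>S i \<inter> K. f i \<omega> (c \<omega>) \<le> f i \<omega> y)"
      proof (rule measurable_minimizer[where K = "S i \<inter> K" and f = "f i" and M = M])
        show "compact (S i \<inter> K)" using S[OF i] K(1) by blast
        show "continuous_on (S i \<inter> K) (f i \<omega>)" if "\<omega> \<in> space M" for \<omega>
          using cont[OF i that] continuous_on_subset by blast
      qed (use False meas[OF i] in blast)+
      define b' where "b' \<omega> = (if F \<omega> (b \<omega>) \<le> F \<omega> (c \<omega>) then b \<omega> else c \<omega>)" for \<omega>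
      have "b' \<in> borel_measurable M"
        unfolding b'_def using comp[OF b(1)] comp[OF c(1)]
        by (intro measurable_If b(1) c(1) borel_measurable_le)
      moreover have "b' \<omega> \<in> K \<and> (\<forall>j\<in>insert i I'. \<forall>y\<in>S j \<inter> K. F \<omega> (b' \<omega>) \<le> f j \<omega> y)"
        if \<omega>: "\<omega> \<in> space M" for \<omega>
      proof -
        have "F \<omega> (c \<omega>) \<le> f i \<omega> (c \<omega>)" using le[OF i \<omega>] c(2)[OF \<omega>] by blast
        then have "\<forall>y\<in>S i \<inter> K. F \<omega> (c \<omega>) \<le> f i \<omega> y" using c(2)[OF \<omega>] order_trans by blast
        moreover have "\<forall>j\<in>I'. \<forall>y\<in>S j \<inter> K. F \<omega> (b \<omega>) \<le> f j \<omega> y" "b \<omega> \<in> K"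
          using b(2) \<omega> by auto
        moreover have "F \<omega> (b' \<omega>) \<le> F \<omega> (b \<omega>)" "F \<omega> (b' \<omega>) \<le> F \<omega> (c \<omega>)"
          by (auto simp: b'_def)
        moreover have "b' \<omega> = b \<omega> \<or> b' \<omega> = c \<omega>" by (simp add: b'_def)
        ultimately show ?thesis
          using c(2)[OF \<omega>] by (metis IntD2 insert_iff order_trans)
      qed
      ultimately show ?thesis by blast
    qed
  qed
  from this[OF I order_refl] obtain b where b: "b \<in> borel_measurable M"
     "\<forall>\<omega>\<in>space M. b \<omega> \<in> K \<and> (\<forall>i\<in>I. \<forall>y\<in>S i \<inter> K. F \<omega> (b \<omega>) \<le> f i \<omega> y)" by blast
  have "b \<omega> \<in> K \<and> (\<forall>y\<in>K. F \<omega> (b \<omega>) \<le> F \<omega> y)" if \<omega>: "\<omega> \<in> space M" for \<omega>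
    using b(2) \<omega> att[OF \<omega>] by (metis IntI)
  with b(1) show thesis by (rule that)
qed

section \<open>The logistic log likelihood near the true parameter\<close>

definition logistic_mean :: "real \<Rightarrow> real" where
  "logistic_mean \<eta> = exp \<eta> / (1 + exp \<eta>)"

definition logistic_variance :: "real \<Rightarrow> real" where
  "logistic_variance \<eta> = exp \<eta> / (1 + exp \<eta>)\<^sup>2"

lemma logistic_mean_bounds: "0 < logistic_mean \<eta>" "logistic_mean \<eta> < 1"
  by (simp_all add: logistic_mean_def add_pos_pos)

lemma logistic_variance_pos: "0 < logistic_variance \<eta>"
proof -
  have "0 < 1 + exp \<eta>" by (intro add_pos_pos) auto
  then show ?thesis by (simp add: logistic_variance_def)
qed

lemma logistic_variance_le_1: "logistic_variance \<eta> \<le> 1"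
proof -
  have "exp \<eta> \<le> (1 + exp \<eta>)\<^sup>2" by (simp add: power2_eq_square algebra_simps add_increasing)
  moreover have "0 < 1 + exp \<eta>" by (intro add_pos_pos) auto
  ultimately show ?thesis by (simp add: logistic_variance_def divide_le_eq)
qed

lemma DERIV_logistic_cumulant: "(logistic_cumulant has_real_derivative logistic_mean \<eta>) (at \<eta>)"
  unfolding logistic_cumulant_def[abs_def] logistic_mean_def
  by (auto intro!: derivative_eq_intros simp: add_pos_pos)

lemma DERIV_logistic_mean: "(logistic_mean has_real_derivative logistic_variance \<eta>) (at \<eta>)"
proof -
  have "1 + exp \<eta> \<noteq> (0::real)" by (smt (verit) exp_gt_zero)
  then show ?thesis
    unfolding logistic_mean_def[abs_def] logistic_variance_def
    by (auto intro!: derivative_eq_intros simp: field_simps power2_eq_square)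
qed

lemma deriv2_logistic_cumulant: "(deriv ^^ 2) logistic_cumulant = logistic_variance"
proof -
  have "deriv logistic_cumulant = logistic_mean"
    using DERIV_imp_deriv[OF DERIV_logistic_cumulant] by blast
  moreover have "deriv logistic_mean = logistic_variance"
    using DERIV_imp_deriv[OF DERIV_logistic_mean] by blast
  ultimately show ?thesis by (simp add: eval_nat_numeral)
qed

lemma convex_logistic_cumulant: "convex_on UNIV logistic_cumulant"
  by (rule f''_ge0_imp_convex[OF _ DERIV_logistic_cumulant DERIV_logistic_mean])
     (auto intro: less_imp_le logistic_variance_pos)

text \<open>
  The curvature changes by at most the factor \<open>exp \<bar>h\<bar>\<close> when its argument moves by \<open>h\<close> (self-concordance).
  A bound relative to the curvature at \<open>\<eta>\<close>, rather than by a constant, lets the Fisher information at the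
  true parameter appear in the quadratic term below.
\<close>

lemma logistic_variance_ge_shift: "exp (- \<bar>h\<bar>) * logistic_variance \<eta> \<le> logistic_variance (\<eta> + h)"
proof -
  have pos: "0 < 1 + exp \<eta>" "0 < 1 + exp (\<eta> + h)" by (simp_all add: add_pos_pos)
  have "exp (- \<bar>h\<bar>) * (1 + exp (\<eta> + h))\<^sup>2 \<le> exp h * (1 + exp \<eta>)\<^sup>2"
  proof (cases "0 \<le> h")
    case True
    have "1 + exp (\<eta> + h) \<le> exp h * (1 + exp \<eta>)"
      using True by (simp add: exp_add algebra_simps)
    then have "(1 + exp (\<eta> + h))\<^sup>2 \<le> (exp h * (1 + exp \<eta>))\<^sup>2"
      using pos by (intro power_mono) auto
    then have "exp (- h) * (1 + exp (\<eta> + h))\<^sup>2 \<le> exp (- h) * (exp h * (1 + exp \<eta>))\<^sup>2"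
      by (intro mult_left_mono) auto
    also have "\<dots> = exp h * (1 + exp \<eta>)\<^sup>2"
      by (simp add: power_mult_distrib power2_eq_square exp_minus field_simps)
    finally show ?thesis using True by simp
  next
    case False
    have "(1 + exp (\<eta> + h))\<^sup>2 \<le> (1 + exp \<eta>)\<^sup>2"
      using False pos by (intro power_mono) auto
    then show ?thesis using False by simp
  qed
  then have "exp \<eta> * (exp (- \<bar>h\<bar>) * (1 + exp (\<eta> + h))\<^sup>2) \<le> exp \<eta> * (exp h * (1 + exp \<eta>)\<^sup>2)"
    by (intro mult_left_mono) auto
  then show ?thesis
    using pos unfolding logistic_variance_def by (simp add: field_simps exp_add)
qed

text \<open>
  Second-order Taylor expansion, with the curvature at the intermediate point replaced by the one at \<open>\<eta>\<close>.
\<close>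

lemma logistic_cumulant_lower_bound:
  "logistic_cumulant \<eta> + h * logistic_mean \<eta> + exp (- \<bar>h\<bar>) / 2 * (logistic_variance \<eta> * h\<^sup>2)
     \<le> logistic_cumulant (\<eta> + h)"
proof (cases "h = 0")
  case False
  define diff where
    "diff = (\<lambda>m::nat. if m = 0 then logistic_cumulant else if m = 1 then logistic_mean else logistic_variance)"
  have "\<exists>t. (if \<eta> + h < \<eta> then \<eta> + h < t \<and> t < \<eta> else \<eta> < t \<and> t < \<eta> + h) \<and>
      logistic_cumulant (\<eta> + h)
        = (\<Sum>m<2. (diff m \<eta> / fact m) * (\<eta> + h - \<eta>) ^ m) + (diff 2 t / fact 2) * (\<eta> + h - \<eta>) ^ 2"
    by (rule Taylor[where a = "\<eta> - \<bar>h\<bar>" and b = "\<eta> + \<bar>h\<bar>"])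
       (use False in \<open>auto simp: diff_def less_2_cases_iff intro: DERIV_logistic_cumulant DERIV_logistic_mean\<close>)
  then obtain t where t': "if \<eta> + h < \<eta> then \<eta> + h < t \<and> t < \<eta> else \<eta> < t \<and> t < \<eta> + h"
    and eq': "logistic_cumulant (\<eta> + h)
        = (\<Sum>m<2. (diff m \<eta> / fact m) * (\<eta> + h - \<eta>) ^ m) + (diff 2 t / fact 2) * (\<eta> + h - \<eta>) ^ 2" by blast
  have t: "\<bar>t - \<eta>\<bar> \<le> \<bar>h\<bar>" using t' by (auto split: if_splits)
  have eq: "logistic_cumulant (\<eta> + h) = logistic_cumulant \<eta> + h * logistic_mean \<eta> + logistic_variance t / 2 * h\<^sup>2"
    using eq' by (simp add: diff_def eval_nat_numeral algebra_simps)
  have "exp (- \<bar>h\<bar>) * logistic_variance \<eta> \<le> exp (- \<bar>t - \<eta>\<bar>) * logistic_variance \<eta>"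
    using t logistic_variance_pos[of \<eta>] by (intro mult_right_mono) auto
  also have "\<dots> \<le> logistic_variance t" using logistic_variance_ge_shift[of "t - \<eta>" \<eta>] by simp
  finally have "exp (- \<bar>h\<bar>) * logistic_variance \<eta> * (h\<^sup>2 / 2) \<le> logistic_variance t * (h\<^sup>2 / 2)"
    by (intro mult_right_mono) auto
  then show ?thesis using eq by (simp add: mult_ac)
qed auto

lemma ln_logistic_density:
  assumes "fst v \<in> {0, 1}"
  shows "ln (logistic_density v \<beta>) = fst v * (snd v \<bullet> \<beta>) - logistic_cumulant (snd v \<bullet> \<beta>)"
proof -
  have pos: "0 < 1 + exp (snd v \<bullet> \<beta>)" by (simp add: add_pos_pos)
  have "1 - exp (snd v \<bullet> \<beta>) / (1 + exp (snd v \<bullet> \<beta>)) = 1 / (1 + exp (snd v \<bullet> \<beta>))"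
    using pos by (simp add: field_simps)
  then show ?thesis
    using assms pos by (auto simp: logistic_density_def logistic_cumulant_def ln_div ln_div)
qed

text \<open>
  The segment from \<open>a\<close> to \<open>x\<close> meets the sphere at \<open>z\<close>, and a convex function increases from \<open>z\<close> to \<open>x\<close>
  at least at its average rate between \<open>a\<close> and \<open>z\<close>.
\<close>

lemma convex_outward_growth:
  fixes g :: "'a::real_normed_vector \<Rightarrow> real"
  assumes g: "convex_on UNIV g" and R: "0 < R"
    and sphere: "\<And>z. norm (z - a) = R \<Longrightarrow> g a + \<gamma> \<le> g z"
    and x: "R \<le> norm (x - a)"
  shows "g a + norm (x - a) / R * \<gamma> \<le> g x"
proof -
  define t where "t = R / norm (x - a)"
  have nz: "0 < norm (x - a)" using R x by linarith
  then have t: "0 < t" "t \<le> 1" using R x by (simp_all add: t_def)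
  define z where "z = (1 - t) *\<^sub>R a + t *\<^sub>R x"
  have "z - a = t *\<^sub>R (x - a)" by (simp add: z_def algebra_simps)
  then have "norm (z - a) = R" using R nz by (simp add: t_def)
  then have "g a + \<gamma> \<le> g z" by (rule sphere)
  also have "\<dots> \<le> (1 - t) * g a + t * g x"
    unfolding z_def using g t by (auto simp: convex_on_def)
  finally have "\<gamma> \<le> t * (g x - g a)" by (simp add: algebra_simps)
  then have "\<gamma> / t \<le> g x - g a" using t by (simp add: field_simps)
  then show ?thesis by (simp add: t_def mult.commute)
qed

lemma sum_weighted_square_inner:
  fixes x :: "nat \<Rightarrow> real ^ 'i::finite"
  shows "(\<Sum>i<n. c i * (x i \<bullet> u)\<^sup>2) = (\<Sum>k\<in>UNIV. \<Sum>l\<in>UNIV. u $ k * u $ l * (\<Sum>i<n. c i * (x i $ k * x i $ l)))"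
proof -
  have "c i * (x i \<bullet> u)\<^sup>2 = (\<Sum>k\<in>UNIV. \<Sum>l\<in>UNIV. u $ k * u $ l * (c i * (x i $ k * x i $ l)))" for i
    by (simp add: inner_vec_def power2_eq_square sum_product sum_distrib_left mult_ac)
  then have "(\<Sum>i<n. c i * (x i \<bullet> u)\<^sup>2) = (\<Sum>i<n. \<Sum>k\<in>UNIV. \<Sum>l\<in>UNIV. u $ k * u $ l * (c i * (x i $ k * x i $ l)))"
    by simp
  also have "\<dots> = (\<Sum>k\<in>UNIV. \<Sum>l\<in>UNIV. \<Sum>i<n. u $ k * u $ l * (c i * (x i $ k * x i $ l)))"
    by (subst sum.swap, rule sum.cong[OF refl], subst sum.swap, rule refl)
  finally show ?thesis by (simp add: sum_distrib_left)
qed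

text \<open>
  What the separation argument needs to know about the data. Convexity is included because it extends the
  bound from the sphere to its exterior.
\<close>

definition likelihood_drop ::
  "nat \<Rightarrow> (nat \<Rightarrow> real \<times> (real ^ 'i::finite)) \<Rightarrow> real ^ 'i \<Rightarrow> real \<Rightarrow> real \<Rightarrow> bool" where
  "likelihood_drop n v \<beta>0 R \<gamma> \<longleftrightarrow>
     convex_on UNIV (\<lambda>\<beta>. - log_likelihood logistic_density n v \<beta>) \<and>
     (\<forall>\<beta>. norm (\<beta> - \<beta>0) = R \<longrightarrow>
        log_likelihood logistic_density n v \<beta> + \<gamma> \<le> log_likelihood logistic_density n v \<beta>0)"

text \<open>
  The expansion at \<open>\<beta>0\<close> of the negative log likelihood consists of the score, which contributes at most
  \<open>d * (T * sqrt n) * (C / sqrt n)\<close>, and of the quadratic form of the empirical information matrix.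
  The latter differs from \<open>n * A\<close> by at most \<open>n * \<tau>\<close> in each entry, which costs at most half of the
  lower bound \<open>\<mu>\<close>. The factor \<open>exp (- d)\<close> bounds the loss of curvature along the way from \<open>\<beta>0\<close> to
  \<open>\<beta>\<close>: the linear predictor moves by at most \<open>d\<close>, since all covariates and all coordinates of
  \<open>\<beta> - \<beta>0\<close> are at most 1 in modulus.
\<close>

lemma log_likelihood_gap_on_sphere:
  fixes \<beta>0 :: "real ^ 'i::finite" and v :: "nat \<Rightarrow> real \<times> (real ^ 'i)" and A :: "real ^ 'i ^ 'i"
  defines "d \<equiv> real CARD('i)"
  assumes y: "\<And>i. i < n \<Longrightarrow> fst (v i) \<in> {0, 1}"
    and x: "\<And>i k. i < n \<Longrightarrow> \<bar>snd (v i) $ k\<bar> \<le> 1"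
    and score: "\<And>k. \<bar>\<Sum>i<n. (fst (v i) - logistic_mean (snd (v i) \<bullet> \<beta>0)) * snd (v i) $ k\<bar> \<le> T * sqrt (real n)"
    and gram: "\<And>k l. \<bar>(\<Sum>i<n. logistic_variance (snd (v i) \<bullet> \<beta>0) * (snd (v i) $ k * snd (v i) $ l)) - real n * A $ k $ l\<bar> \<le> real n * \<tau>"
    and A: "\<And>u. \<mu> * (norm u)\<^sup>2 \<le> u \<bullet> (A *v u)"
    and \<tau>: "0 \<le> \<tau>" "d\<^sup>2 * \<tau> \<le> \<mu> / 2"
    and n: "0 < n" and C: "0 < C" "C \<le> sqrt (real n)"
    and \<beta>: "norm (\<beta> - \<beta>0) = C / sqrt (real n)"
  shows "log_likelihood logistic_density n v \<beta> + (exp (- d) * \<mu> / 4 * C\<^sup>2 - d * T * C)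
           \<le> log_likelihood logistic_density n v \<beta>0"
proof -
  define u where "u = \<beta> - \<beta>0"
  define R where "R = C / sqrt (real n)"
  have sn: "0 < sqrt (real n)" using n by simp
  have R: "0 < R" "R \<le> 1" "norm u = R" "sqrt (real n) * R = C" "real n * R\<^sup>2 = C\<^sup>2"
    using C sn \<beta> by (simp_all add: R_def u_def power_divide)
  have uk: "\<bar>u $ k\<bar> \<le> R" for k using component_le_norm_cart[of u k] R(3) by simp
  let ?x = "\<lambda>i. snd (v i)" and ?y = "\<lambda>i. fst (v i)"
  let ?h = "\<lambda>i. snd (v i) \<bullet> u" and ?e = "\<lambda>i. snd (v i) \<bullet> \<beta>0"
  have h: "\<bar>?h i\<bar> \<le> d" if "i < n" for i
  proof -
    have "\<bar>?h i\<bar> \<le> (\<Sum>k\<in>UNIV. \<bar>?x i $ k * u $ k\<bar>)" unfolding inner_vec_def by (simp add: sum_abs)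
    also have "\<dots> \<le> (\<Sum>k\<in>(UNIV::'i set). 1)"
    proof (rule sum_mono)
      fix k
      have "\<bar>?x i $ k\<bar> * \<bar>u $ k\<bar> \<le> 1 * 1" using x[OF that, of k] uk[of k] R(2) by (intro mult_mono) auto
      then show "\<bar>?x i $ k * u $ k\<bar> \<le> 1" by (simp add: abs_mult)
    qed
    finally show ?thesis by (simp add: d_def)
  qed
  have summand: "(logistic_mean (?e i) - ?y i) * ?h i + exp (- d) / 2 * (logistic_variance (?e i) * (?h i)\<^sup>2)
      \<le> ln (logistic_density (v i) \<beta>0) - ln (logistic_density (v i) \<beta>)" if i: "i < n" for i
  proof -
    have "exp (- d) / 2 * (logistic_variance (?e i) * (?h i)\<^sup>2)
        \<le> exp (- \<bar>?h i\<bar>) / 2 * (logistic_variance (?e i) * (?h i)\<^sup>2)"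
      using h[OF i] logistic_variance_pos[of "?e i"] by (intro mult_right_mono) auto
    moreover have "logistic_cumulant (?x i \<bullet> \<beta>) = logistic_cumulant (?e i + ?h i)"
      by (simp add: u_def inner_diff_right)
    ultimately have "?h i * logistic_mean (?e i) + exp (- d) / 2 * (logistic_variance (?e i) * (?h i)\<^sup>2)
        \<le> logistic_cumulant (?x i \<bullet> \<beta>) - logistic_cumulant (?e i)"
      using logistic_cumulant_lower_bound[of "?e i" "?h i"] by linarith
    then show ?thesis
      unfolding ln_logistic_density[OF y[OF i]] by (simp add: u_def inner_diff_right algebra_simps)
  qed
  have S: "\<bar>\<Sum>i<n. (?y i - logistic_mean (?e i)) * ?h i\<bar> \<le> d * T * C"
  proof -
    have "(\<Sum>i<n. (?y i - logistic_mean (?e i)) * ?h i)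
        = (\<Sum>k\<in>UNIV. u $ k * (\<Sum>i<n. (?y i - logistic_mean (?e i)) * ?x i $ k))"
      unfolding inner_vec_def sum_distrib_left by (subst sum.swap) (simp add: mult_ac)
    also have "\<bar>\<dots>\<bar> \<le> (\<Sum>k\<in>UNIV. \<bar>u $ k\<bar> * \<bar>\<Sum>i<n. (?y i - logistic_mean (?e i)) * ?x i $ k\<bar>)"
      by (rule order_trans[OF sum_abs]) (simp add: abs_mult)
    also have "\<dots> \<le> (\<Sum>k\<in>(UNIV::'i set). R * (T * sqrt (real n)))"
      using R by (intro sum_mono mult_mono uk score) auto
    also have "\<dots> = d * T * (sqrt (real n) * R)" by (simp add: d_def)
    finally show ?thesis by (simp add: R)
  qed
  have Q: "\<mu> / 2 * C\<^sup>2 \<le> (\<Sum>i<n. logistic_variance (?e i) * (?h i)\<^sup>2)"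
  proof -
    let ?G = "\<lambda>k l. \<Sum>i<n. logistic_variance (?e i) * (?x i $ k * ?x i $ l)"
    have "u \<bullet> (A *v u) = (\<Sum>k\<in>UNIV. \<Sum>l\<in>UNIV. u $ k * u $ l * A $ k $ l)"
      by (simp add: inner_vec_def matrix_vector_mult_def sum_distrib_left mult_ac)
    then have "(\<Sum>i<n. logistic_variance (?e i) * (?h i)\<^sup>2) - real n * (u \<bullet> (A *v u))
        = (\<Sum>k\<in>UNIV. \<Sum>l\<in>UNIV. u $ k * u $ l * (?G k l - real n * A $ k $ l))"
      unfolding sum_weighted_square_inner
      by (simp add: sum_subtractf right_diff_distrib sum_distrib_left mult_ac)
    moreover have "\<bar>\<Sum>k\<in>UNIV. \<Sum>l\<in>UNIV. u $ k * u $ l * (?G k l - real n * A $ k $ l)\<bar>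
        \<le> (\<Sum>k\<in>(UNIV::'i set). \<Sum>l\<in>(UNIV::'i set). R * R * (real n * \<tau>))"
    proof (intro order_trans[OF sum_abs] sum_mono)
      fix k l
      show "\<bar>u $ k * u $ l * (?G k l - real n * A $ k $ l)\<bar> \<le> R * R * (real n * \<tau>)"
        unfolding abs_mult using R \<tau> by (intro mult_mono uk gram) auto
    qed
    moreover have "(\<Sum>k\<in>(UNIV::'i set). \<Sum>l\<in>(UNIV::'i set). R * R * (real n * \<tau>)) = real n * R\<^sup>2 * (d\<^sup>2 * \<tau>)"
      by (simp add: d_def power2_eq_square)
    moreover have "real n * R\<^sup>2 * (d\<^sup>2 * \<tau>) \<le> real n * R\<^sup>2 * (\<mu> / 2)"
      using \<tau> by (intro mult_left_mono) auto
    moreover have "real n * (\<mu> * R\<^sup>2) \<le> real n * (u \<bullet> (A *v u))"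
      using A[of u] R(3) by (intro mult_left_mono) auto
    ultimately have ge: "real n * (\<mu> * R\<^sup>2) - real n * R\<^sup>2 * (\<mu> / 2) \<le> (\<Sum>i<n. logistic_variance (?e i) * (?h i)\<^sup>2)"
      by linarith
    have eq: "real n * (\<mu> * R\<^sup>2) - real n * R\<^sup>2 * (\<mu> / 2) = \<mu> / 2 * C\<^sup>2"
      by (simp add: R(5)[symmetric] algebra_simps)
    show ?thesis using ge unfolding eq .
  qed
  have "(\<Sum>i<n. (logistic_mean (?e i) - ?y i) * ?h i) + exp (- d) / 2 * (\<Sum>i<n. logistic_variance (?e i) * (?h i)\<^sup>2)
      \<le> log_likelihood logistic_density n v \<beta>0 - log_likelihood logistic_density n v \<beta>"
    unfolding log_likelihood_def sum_subtractf[symmetric] sum_distrib_left sum.distrib[symmetric]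
    by (intro sum_mono summand) auto
  moreover have "(\<Sum>i<n. (logistic_mean (?e i) - ?y i) * ?h i) = - (\<Sum>i<n. (?y i - logistic_mean (?e i)) * ?h i)"
    by (simp add: sum_negf[symmetric] algebra_simps)
  moreover have "exp (- d) / 2 * (\<mu> / 2 * C\<^sup>2) \<le> exp (- d) / 2 * (\<Sum>i<n. logistic_variance (?e i) * (?h i)\<^sup>2)"
    using Q by (intro mult_left_mono) auto
  moreover have "exp (- d) / 2 * (\<mu> / 2 * C\<^sup>2) = exp (- d) * \<mu> / 4 * C\<^sup>2" by simp
  ultimately show ?thesis using S unfolding abs_le_iff by linarith
qed

lemma convex_neg_log_likelihood:
  fixes v :: "nat \<Rightarrow> real \<times> (real ^ 'i::finite)"
  assumes y: "\<And>i. i < n \<Longrightarrow> fst (v i) \<in> {0, 1}"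
  shows "convex_on UNIV (\<lambda>\<beta>. - log_likelihood logistic_density n v \<beta>)"
proof (rule convex_onI)
  fix t :: real and a b :: "real ^ 'i"
  assume t: "0 < t" "t < 1"
  have "- ln (logistic_density (v i) ((1 - t) *\<^sub>R a + t *\<^sub>R b))
      \<le> (1 - t) * - ln (logistic_density (v i) a) + t * - ln (logistic_density (v i) b)" if "i < n" for i
    using convex_onD[OF convex_logistic_cumulant, of t "snd (v i) \<bullet> a" "snd (v i) \<bullet> b"] t
    by (simp add: ln_logistic_density[OF y[OF that]] inner_add_right algebra_simps)
  then have "(\<Sum>i<n. - ln (logistic_density (v i) ((1 - t) *\<^sub>R a + t *\<^sub>R b)))
      \<le> (\<Sum>i<n. (1 - t) * - ln (logistic_density (v i) a) + t * - ln (logistic_density (v i) b))"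
    by (intro sum_mono) auto
  then show "- log_likelihood logistic_density n v ((1 - t) *\<^sub>R a + t *\<^sub>R b)
      \<le> (1 - t) * - log_likelihood logistic_density n v a + t * - log_likelihood logistic_density n v b"
    by (simp add: log_likelihood_def sum.distrib sum_negf sum_distrib_left sum_subtractf)
qed simp

section \<open>The penalised criterion\<close>

definition fusion_pairs :: "nat \<Rightarrow> (nat \<Rightarrow> nat) \<Rightarrow> (nat \<times> nat \<times> nat) set" where
  "fusion_pairs J p = (SIGMA j:{1..J}. {(r, s). r < s \<and> s \<le> p j})"

definition fusion_subspace ::
  "(nat \<times> nat \<Rightarrow> 'd::finite) \<Rightarrow> (nat \<times> nat \<times> nat) set \<Rightarrow> (real ^ 'd option) set" where
  "fusion_subspace ix P = {\<beta>. \<forall>(j, r, s)\<in>P. coef ix \<beta> j r = coef ix \<beta> j s}"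

text \<open>
  The \<open>L\<^sub>0\<close> penalty is charged for all pairs outside the pattern \<open>P\<close>, whatever the value of \<open>\<beta>\<close>. For fixed
  \<open>P\<close> it is thus a constant, and the criterion is continuous in \<open>\<beta>\<close>.
\<close>

definition fused_criterion ::
  "nat \<Rightarrow> (nat \<Rightarrow> nat) \<Rightarrow> (nat \<times> nat \<Rightarrow> 'd::finite) \<Rightarrow> nat \<Rightarrow> (nat \<Rightarrow> real \<times> (real ^ 'd option))
     \<Rightarrow> real \<Rightarrow> (nat \<Rightarrow> real) \<Rightarrow> real \<Rightarrow> (nat \<Rightarrow> nat \<Rightarrow> nat \<Rightarrow> real)
     \<Rightarrow> (nat \<times> nat \<times> nat) set \<Rightarrow> real ^ 'd option \<Rightarrow> real" where
  "fused_criterion J p ix n v lam1 w1 lam0 w0 P \<beta> =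
     - log_likelihood logistic_density n v \<beta>
     + lam1 * (\<Sum>j=1..J. w1 j * L2_set (coef ix \<beta> j) {1..p j})
     + lam0 * (\<Sum>j=1..J. \<Sum>(r, s)\<in>{(r, s). r < s \<and> s \<le> p j}. w0 j r s * of_bool ((j, r, s) \<notin> P))"

lemma finite_level_pairs: "finite {(r, s). r < s \<and> s \<le> (m::nat)}"
  by (rule finite_subset[of _ "{..m} \<times> {..m}"]) auto

lemma finite_fusion_pairs: "finite (fusion_pairs J p)"
  unfolding fusion_pairs_def by (intro finite_SigmaI finite_level_pairs) auto

lemma continuous_coef: "continuous_on UNIV (\<lambda>\<beta>. coef ix \<beta> j k)"
  unfolding coef_def by (cases "k = 0") (auto intro!: continuous_intros)

lemma closed_fusion_subspace: "closed (fusion_subspace ix P)"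
proof -
  have "fusion_subspace ix P = (\<Inter>(j, r, s)\<in>P. {\<beta>. coef ix \<beta> j r = coef ix \<beta> j s})"
    by (auto simp: fusion_subspace_def)
  also have "closed \<dots>"
    by (intro closed_INT ballI) (auto intro!: closed_Collect_eq continuous_coef)
  finally show ?thesis .
qed

lemma logistic_density_pos: "0 < logistic_density v \<beta>"
proof -
  have "0 < 1 + exp (snd v \<bullet> \<beta>)" by (intro add_pos_pos) auto
  then show ?thesis by (simp add: logistic_density_def Let_def field_simps)
qed

lemma continuous_fused_criterion:
  "continuous_on UNIV (fused_criterion J p ix n v lam1 w1 lam0 w0 P)"
proof -
  have d: "continuous_on UNIV (\<lambda>\<beta>. ln (logistic_density (v i) \<beta>))" for i
  proof -
    have "1 + exp (snd (v i) \<bullet> \<beta>) \<noteq> 0" for \<beta>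
      by (metis add_pos_pos exp_gt_zero less_irrefl zero_less_one)
    then have "continuous_on UNIV (logistic_density (v i))"
      unfolding logistic_density_def[abs_def] Let_def
      by (cases "fst (v i) = 1") (auto intro!: continuous_intros)
    then show ?thesis
      using logistic_density_pos[of "v i"] by (intro continuous_on_ln) (auto simp: less_le)
  qed
  show ?thesis
    unfolding fused_criterion_def[abs_def] log_likelihood_def L2_set_def
    by (intro continuous_intros d continuous_coef)
qed

text \<open>
  A point of the subspace may fuse more levels than \<open>P\<close> demands; the true penalty is then smaller than
  the one charged for \<open>P\<close>. Together with the next lemma, the criterion is the minimum of its pieces.
\<close>

lemma M_pen_le_fused_criterion:
  assumes "0 \<le> lam0" and w0: "\<And>j r s. j \<in> {1..J} \<Longrightarrow> r < s \<Longrightarrow> s \<le> p j \<Longrightarrow> 0 \<le> w0 j r s"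
    and \<beta>: "\<beta> \<in> fusion_subspace ix P"
  shows "M_pen J p ix n v lam1 w1 lam0 w0 \<beta> \<le> fused_criterion J p ix n v lam1 w1 lam0 w0 P \<beta>"
proof -
  have "l0_norm (coef ix \<beta> j r - coef ix \<beta> j s) \<le> of_bool ((j, r, s) \<notin> P)" for j r s
    using \<beta> by (auto simp: l0_norm_def fusion_subspace_def)
  then have "(\<Sum>j=1..J. \<Sum>(r, s)\<in>{(r, s). r < s \<and> s \<le> p j}. w0 j r s * l0_norm (coef ix \<beta> j r - coef ix \<beta> j s))
      \<le> (\<Sum>j=1..J. \<Sum>(r, s)\<in>{(r, s). r < s \<and> s \<le> p j}. w0 j r s * of_bool ((j, r, s) \<notin> P))"
    by (intro sum_mono) (auto simp only: mem_Collect_eq case_prod_conv split_beta intro!: mult_left_mono w0)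
  then show ?thesis
    unfolding M_pen_def fused_criterion_def using assms(1) by (intro add_left_mono mult_left_mono)
qed

lemma M_pen_eq_fused_criterion:
  "\<exists>P\<in>Pow (fusion_pairs J p). \<beta> \<in> fusion_subspace ix P \<and>
     M_pen J p ix n v lam1 w1 lam0 w0 \<beta> = fused_criterion J p ix n v lam1 w1 lam0 w0 P \<beta>"
proof -
  define P where "P = {(j, r, s) \<in> fusion_pairs J p. coef ix \<beta> j r = coef ix \<beta> j s}"
  have "l0_norm (coef ix \<beta> j r - coef ix \<beta> j s) = of_bool ((j, r, s) \<notin> P)"
    if "j \<in> {1..J}" "(r, s) \<in> {(r, s). r < s \<and> s \<le> p j}" for j r s
    using that by (auto simp: P_def l0_norm_def fusion_pairs_def)
  then have "(\<Sum>(r, s)\<in>{(r, s). r < s \<and> s \<le> p j}. w0 j r s * l0_norm (coef ix \<beta> j r - coef ix \<beta> j s))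
      = (\<Sum>(r, s)\<in>{(r, s). r < s \<and> s \<le> p j}. w0 j r s * of_bool ((j, r, s) \<notin> P))"
    if "j \<in> {1..J}" for j
    using that by (intro sum.cong refl) auto
  then have "M_pen J p ix n v lam1 w1 lam0 w0 \<beta> = fused_criterion J p ix n v lam1 w1 lam0 w0 P \<beta>"
    unfolding M_pen_def fused_criterion_def by simp
  moreover have "P \<in> Pow (fusion_pairs J p)" "\<beta> \<in> fusion_subspace ix P"
    by (auto simp: P_def fusion_subspace_def)
  ultimately show ?thesis by blast
qed

lemma borel_measurable_ln_logistic_density:
  fixes X :: "'a \<Rightarrow> real \<times> (real ^ 'i::finite)"
  assumes X: "X \<in> borel_measurable M" and b: "b \<in> borel_measurable M"
  shows "(\<lambda>\<omega>. ln (logistic_density (X \<omega>) (b \<omega>))) \<in> borel_measurable M"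
proof -
  have [measurable]: "(\<lambda>\<omega>. fst (X \<omega>)) \<in> borel_measurable M" "(\<lambda>\<omega>. snd (X \<omega>)) \<in> borel_measurable M"
    by (auto intro!: measurable_compose[OF X] borel_measurable_continuous_onI continuous_intros)
  note b[measurable]
  show ?thesis unfolding logistic_density_def Let_def by measurable
qed

lemma borel_measurable_coef:
  assumes "b \<in> borel_measurable M"
  shows "(\<lambda>\<omega>. coef ix (b \<omega>) j k) \<in> borel_measurable M"
  by (rule measurable_compose[OF assms borel_measurable_continuous_onI[OF continuous_coef]])

lemma borel_measurable_group_penalised_likelihood:
  assumes V: "\<And>i. V i \<in> borel_measurable M" and b: "b \<in> borel_measurable M"
    and w1: "\<And>j. j \<in> {1..J} \<Longrightarrow> w1 j \<in> borel_measurable M"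
  shows "(\<lambda>\<omega>. - log_likelihood logistic_density n (\<lambda>i. V i \<omega>) (b \<omega>)
     + lam1 * (\<Sum>j=1..J. w1 j \<omega> * L2_set (coef ix (b \<omega>) j) {1..p j})) \<in> borel_measurable M"
  unfolding log_likelihood_def L2_set_def
  using borel_measurable_ln_logistic_density[OF V b] borel_measurable_coef[OF b, of ix] w1
  by (intro borel_measurable_add borel_measurable_uminus borel_measurable_sum borel_measurable_times
       borel_measurable_const borel_measurable_power measurable_compose[OF _ borel_measurable_sqrt]) auto

lemma borel_measurable_M_pen:
  assumes V: "\<And>i. V i \<in> borel_measurable M" and b: "b \<in> borel_measurable M"
    and w1: "\<And>j. j \<in> {1..J} \<Longrightarrow> w1 j \<in> borel_measurable M"
    and w0: "\<And>j r s. j \<in> {1..J} \<Longrightarrow> r < s \<Longrightarrow> s \<le> p j \<Longrightarrow> w0 j r s \<in> borel_measurable M"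
  shows "(\<lambda>\<omega>. M_pen J p ix n (\<lambda>i. V i \<omega>) lam1 (\<lambda>j. w1 j \<omega>) lam0 (\<lambda>j r s. w0 j r s \<omega>) (b \<omega>))
           \<in> borel_measurable M"
proof -
  have "(\<lambda>\<omega>. l0_norm (coef ix (b \<omega>) j r - coef ix (b \<omega>) j s)) \<in> borel_measurable M" for j r s
    unfolding l0_norm_def using borel_measurable_coef[OF b, of ix, measurable] by measurable
  then show ?thesis
    unfolding M_pen_def split_beta using w0
    by (intro borel_measurable_add[OF borel_measurable_group_penalised_likelihood[OF V b w1]]
         borel_measurable_sum borel_measurable_times) auto
qed

lemma borel_measurable_fused_criterion:
  assumes V: "\<And>i. V i \<in> borel_measurable M"
    and w1: "\<And>j. j \<in> {1..J} \<Longrightarrow> w1 j \<in> borel_measurable M"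
    and w0: "\<And>j r s. j \<in> {1..J} \<Longrightarrow> r < s \<Longrightarrow> s \<le> p j \<Longrightarrow> w0 j r s \<in> borel_measurable M"
  shows "(\<lambda>\<omega>. fused_criterion J p ix n (\<lambda>i. V i \<omega>) lam1 (\<lambda>j. w1 j \<omega>) lam0 (\<lambda>j r s. w0 j r s \<omega>) P \<beta>)
           \<in> borel_measurable M"
  unfolding fused_criterion_def split_beta using w0
  by (intro borel_measurable_add[OF borel_measurable_group_penalised_likelihood[OF V _ w1]]
       borel_measurable_sum borel_measurable_times) auto

text \<open>
  Each group norm is Lipschitz with constant 1 because the coefficients of a factor are distinct
  coordinates of the parameter vector.
\<close>

lemma L2_set_coef_triangle:
  assumes ix: "inj_on ix (dummy_index J p)" and j: "j \<in> {1..J}"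
  shows "L2_set (coef ix \<beta>0 j) {1..p j} \<le> L2_set (coef ix \<beta> j) {1..p j} + norm (\<beta> - \<beta>0)"
proof -
  have inj: "inj_on (\<lambda>k. Some (ix (j, k))) {1..p j}"
    using j by (intro inj_onI) (auto dest!: inj_onD[OF ix] simp: dummy_index_def)
  have "L2_set (\<lambda>k. coef ix \<beta>0 j k) {1..p j}
      = L2_set (\<lambda>k. coef ix \<beta> j k + coef ix (\<beta>0 - \<beta>) j k) {1..p j}"
    by (auto intro!: L2_set_cong simp: coef_def)
  also have "\<dots> \<le> L2_set (\<lambda>k. coef ix \<beta> j k) {1..p j} + L2_set (\<lambda>k. coef ix (\<beta>0 - \<beta>) j k) {1..p j}"
    by (rule L2_set_triangle_ineq)
  also have "L2_set (\<lambda>k. coef ix (\<beta>0 - \<beta>) j k) {1..p j}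
      = L2_set (\<lambda>i. (\<beta>0 - \<beta>) $ i) ((\<lambda>k. Some (ix (j, k))) ` {1..p j})"
    unfolding L2_set_def by (subst sum.reindex[OF inj]) (auto simp: coef_def intro!: sum.cong)
  also have "\<dots> \<le> L2_set (\<lambda>i. (\<beta>0 - \<beta>) $ i) UNIV"
    unfolding L2_set_def by (intro real_sqrt_le_mono sum_mono2) auto
  also have "\<dots> = norm (\<beta> - \<beta>0)"
    by (simp add: norm_vec_def L2_set_def norm_minus_commute[of \<beta>0] power2_commute)
  finally show ?thesis by (simp add: add_left_mono)
qed

text \<open>
  At distance \<open>\<delta> \<ge> R\<close> the likelihood gap is at least \<open>\<delta> / R * \<gamma>\<close> and the group penalties decrease by at most
  \<open>J * \<kappa> * \<delta>\<close>. Both are linear in \<open>\<delta>\<close>, so their comparison is decided at \<open>\<delta> = R\<close>. The \<open>L\<^sub>0\<close> penalty at \<open>\<beta>\<close>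
  is bounded below by 0 and at \<open>\<beta>0\<close> above by \<open>\<nu>\<close> per pair of levels.
\<close>

lemma M_pen_separation:
  fixes ix :: "nat \<times> nat \<Rightarrow> 'd::finite" and \<beta>0 :: "real ^ 'd option"
  assumes ix: "inj_on ix (dummy_index J p)"
    and lam0: "0 \<le> lam0" and w0: "\<And>j r s. j \<in> {1..J} \<Longrightarrow> r < s \<Longrightarrow> s \<le> p j \<Longrightarrow> 0 \<le> w0 j r s"
    and lam1: "0 \<le> lam1" and w1: "\<And>j. j \<in> {1..J} \<Longrightarrow> 0 \<le> w1 j"
    and \<kappa>: "\<And>j. j \<in> {1..J} \<Longrightarrow> lam1 * w1 j \<le> \<kappa>"
    and \<nu>: "0 \<le> \<nu>" "\<And>j r s. j \<in> {1..J} \<Longrightarrow> r < s \<Longrightarrow> s \<le> p j \<Longrightarrow> lam0 * w0 j r s \<le> \<nu>"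
    and drop: "likelihood_drop n v \<beta>0 R \<gamma>" and R: "0 < R"
    and \<gamma>: "real J * \<kappa> * R + real (card (fusion_pairs J p)) * \<nu> < \<gamma>"
    and \<beta>: "R \<le> norm (\<beta> - \<beta>0)"
  shows "M_pen J p ix n v lam1 w1 lam0 w0 \<beta>0 < M_pen J p ix n v lam1 w1 lam0 w0 \<beta>"
proof -
  define \<delta> where "\<delta> = norm (\<beta> - \<beta>0)"
  let ?L = "log_likelihood logistic_density n v"
  let ?N = "real (card (fusion_pairs J p))"
  let ?G = "\<lambda>\<beta>. lam1 * (\<Sum>j=1..J. w1 j * L2_set (coef ix \<beta> j) {1..p j})"
  let ?H = "\<lambda>\<beta>. lam0 * (\<Sum>j=1..J. \<Sum>(r, s)\<in>{(r, s). r < s \<and> s \<le> p j}. w0 j r s * l0_norm (coef ix \<beta> j r - coef ix \<beta> j s))"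
  have lik: "?L \<beta> + \<delta> / R * \<gamma> \<le> ?L \<beta>0"
  proof -
    have "- ?L \<beta>0 + norm (\<beta> - \<beta>0) / R * \<gamma> \<le> - ?L \<beta>"
      using drop unfolding likelihood_drop_def
      by (intro convex_outward_growth[OF _ R _ \<beta>]) auto
    then show ?thesis by (simp add: \<delta>_def)
  qed
  have pen1: "?G \<beta>0 \<le> ?G \<beta> + real J * \<kappa> * \<delta>"
  proof -
    have "?G \<beta>0 \<le> lam1 * (\<Sum>j=1..J. w1 j * (L2_set (coef ix \<beta> j) {1..p j} + \<delta>))"
      unfolding \<delta>_def
      by (intro mult_left_mono sum_mono L2_set_coef_triangle[OF ix] w1 lam1) auto
    also have "\<dots> = ?G \<beta> + (\<Sum>j=1..J. lam1 * w1 j * \<delta>)"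
      by (simp add: distrib_left sum.distrib sum_distrib_left mult_ac)
    also have "(\<Sum>j=1..J. lam1 * w1 j * \<delta>) \<le> (\<Sum>j=1..J. \<kappa> * \<delta>)"
      by (intro sum_mono mult_right_mono \<kappa>) (auto simp: \<delta>_def)
    finally show ?thesis by simp
  qed
  have nonneg0: "0 \<le> ?H \<beta>"
    by (intro mult_nonneg_nonneg lam0 sum_nonneg) (auto simp: l0_norm_def intro!: w0 mult_nonneg_nonneg)
  have le0: "?H \<beta>0 \<le> ?N * \<nu>"
  proof -
    have "?H \<beta>0 = (\<Sum>j=1..J. \<Sum>(r, s)\<in>{(r, s). r < s \<and> s \<le> p j}. lam0 * w0 j r s * l0_norm (coef ix \<beta>0 j r - coef ix \<beta>0 j s))"
      by (simp add: sum_distrib_left split_beta mult_ac)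
    also have "\<dots> \<le> (\<Sum>j=1..J. \<Sum>(r, s)\<in>{(r, s). r < s \<and> s \<le> p j}. \<nu>)"
    proof (intro sum_mono, clarsimp)
      fix j r s assume "Suc 0 \<le> j" "j \<le> J" "r < s" "s \<le> p j"
      then have "lam0 * w0 j r s \<le> \<nu>" by (intro \<nu>(2)) auto
      then show "lam0 * w0 j r s * l0_norm (coef ix \<beta>0 j r - coef ix \<beta>0 j s) \<le> \<nu>"
        using \<nu>(1) by (simp add: l0_norm_def)
    qed
    also have "\<dots> = (\<Sum>x\<in>fusion_pairs J p. \<nu>)"
      unfolding fusion_pairs_def by (subst sum.Sigma) (auto simp: finite_level_pairs split_beta)
    finally show ?thesis by simp
  qed
  have "1 * (\<gamma> - real J * \<kappa> * R) \<le> \<delta> / R * (\<gamma> - real J * \<kappa> * R)"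
  proof (rule mult_right_mono)
    show "1 \<le> \<delta> / R" using \<beta> R by (simp add: \<delta>_def)
    have "0 \<le> ?N * \<nu>" using \<nu>(1) by simp
    then show "0 \<le> \<gamma> - real J * \<kappa> * R" using \<gamma> by linarith
  qed
  also have "\<dots> = \<delta> / R * \<gamma> - real J * \<kappa> * \<delta>" using R by (simp add: field_simps)
  finally have "\<gamma> - real J * \<kappa> * R \<le> \<delta> / R * \<gamma> - real J * \<kappa> * \<delta>" by (simp only: mult_1)
  moreover have "w + c < z" if "x - y \<le> z - w" "y + c < x" for x y z w c :: real
    using that by linarith
  ultimately have "real J * \<kappa> * \<delta> + ?N * \<nu> < \<delta> / R * \<gamma>" using \<gamma> by blast
  then have "- ?L \<beta>0 + ?G \<beta>0 + ?H \<beta>0 < - ?L \<beta> + ?G \<beta> + ?H \<beta>"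
    using lik pen1 nonneg0 le0 by linarith
  then show ?thesis unfolding M_pen_def .
qed

section \<open>Concentration of the score and of the Fisher information\<close>

lemma iid_sum_concentration:
  fixes V :: "nat \<Rightarrow> 'a \<Rightarrow> 'b::{second_countable_topology, t2_space}" and \<psi> :: "'b \<Rightarrow> real"
  assumes prob: "prob_space \<Omega>" and indep: "prob_space.indep_vars \<Omega> (\<lambda>_. borel) V UNIV"
    and distr: "\<And>i. distr \<Omega> borel (V i) = D"
    and \<psi>: "\<psi> \<in> borel_measurable borel" and bounds: "AE v in D. a \<le> \<psi> v \<and> \<psi> v \<le> b"
    and ab: "a < b" and n: "0 < n" and t: "0 \<le> t"
  shows "measure \<Omega> {\<omega> \<in> space \<Omega>. t \<le> \<bar>(\<Sum>i<n. \<psi> (V i \<omega>)) - real n * (\<integral>v. \<psi> v \<partial>D)\<bar>}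
           \<le> 2 * exp (- 2 * t\<^sup>2 / (real n * (b - a)\<^sup>2))"
proof -
  interpret prob_space \<Omega> by fact
  have V: "V i \<in> borel_measurable \<Omega>" for i
    using indep by (auto simp: indep_vars_def)
  have law: "distr \<Omega> borel (\<lambda>\<omega>. \<psi> (V i \<omega>)) = distr D borel \<psi>" for i
    using distr_distr[OF \<psi> V[of i]] by (simp add: distr comp_def)
  have mean: "expectation (\<lambda>\<omega>. \<psi> (V 0 \<omega>)) = (\<integral>v. \<psi> v \<partial>D)"
    using integral_distr[OF V[of 0] \<psi>] by (simp add: distr)
  have ne: "{..<n} \<noteq> {}" using n by auto
  interpret H: Hoeffding_ineq_iid \<Omega> "{..<n}" "\<lambda>i \<omega>. \<psi> (V i \<omega>)" "\<lambda>\<omega>. \<psi> (V 0 \<omega>)" a b "expectation (\<lambda>\<omega>. \<psi> (V 0 \<omega>))"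
  proof unfold_locales
    show "indep_vars (\<lambda>_. borel) (\<lambda>i \<omega>. \<psi> (V i \<omega>)) {..<n}"
      by (rule indep_vars_compose2[OF indep_vars_subset[OF indep subset_UNIV], where Y = "\<lambda>_. \<psi>"])
         (rule \<psi>)
    have "AE v in distr \<Omega> borel (V 0). a \<le> \<psi> v \<and> \<psi> v \<le> b"
      using bounds by (simp only: distr)
    from AE_distrD[OF V this] show "AE \<omega> in \<Omega>. \<psi> (V 0 \<omega>) \<in> {a..b}" by simp
    show "distr \<Omega> borel (\<lambda>\<omega>. \<psi> (V i \<omega>)) = distr \<Omega> borel (\<lambda>\<omega>. \<psi> (V 0 \<omega>))" for i
      by (simp only: law)
    show "random_variable borel (\<lambda>\<omega>. \<psi> (V 0 \<omega>))" using measurable_compose[OF V \<psi>] .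
  qed simp
  show ?thesis
    by (rule H.Hoeffding_ineq_abs_ge[OF t ab ne, unfolded mean card_lessThan])
qed

text \<open>
  The covariate \<open>snd v $ k\<close> is measurable with respect to the sigma-algebra of the covariates, so \<open>fst v\<close>
  may be replaced under the integral by its conditional expectation, which the model identifies.
\<close>

lemma logistic_score_mean_zero:
  fixes D :: "(real \<times> (real ^ 'i::finite)) measure"
  assumes D: "prob_space D" "sets D = sets borel"
    and y: "AE v in D. fst v \<in> {0, 1}" and x: "AE v in D. \<bar>snd v $ k\<bar> \<le> 1"
    and model: "logistic_model D \<beta>"
  shows "(\<integral>v. (fst v - logistic_mean (snd v \<bullet> \<beta>)) * snd v $ k \<partial>D) = 0"
proof -
  interpret prob_space D by fact
  define F where "F = vimage_algebra (space D) (snd :: real \<times> (real ^ 'i) \<Rightarrow> _) borel"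
  have fst_m [measurable]: "fst \<in> borel_measurable D" and snd_m [measurable]: "snd \<in> borel_measurable D"
    unfolding measurable_cong_sets[OF D(2) refl]
    by (intro borel_measurable_continuous_onI continuous_intros)+
  have mean_m [measurable]: "logistic_mean \<in> borel_measurable borel"
    unfolding logistic_mean_def[abs_def] by measurable
  have sub: "subalgebra D F"
    unfolding subalgebra_def F_def using sets_image_in_sets[OF refl snd_m] by simp
  interpret finite_measure_subalgebra D F
    by unfold_locales (rule sub)
  have xF: "(\<lambda>v. snd v $ k) \<in> borel_measurable F"
    unfolding F_def by (rule measurable_compose[OF measurable_vimage_algebra1]) auto
  have xm [measurable]: "(\<lambda>v. snd v $ k) \<in> borel_measurable D"
    by (rule measurable_compose[OF snd_m]) auto
  have i1: "integrable D (\<lambda>v. snd v $ k * fst v)"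
  proof (rule integrable_const_bound[where B = 1])
    show "AE v in D. norm (snd v $ k * fst v) \<le> 1" using x y by eventually_elim (auto simp: abs_mult)
  qed measurable
  have i2: "integrable D (\<lambda>v. snd v $ k * logistic_mean (snd v \<bullet> \<beta>))"
  proof (rule integrable_const_bound[where B = 1])
    show "AE v in D. norm (snd v $ k * logistic_mean (snd v \<bullet> \<beta>)) \<le> 1"
      using x
    proof eventually_elim
      case (elim v)
      have "\<bar>snd v $ k\<bar> * \<bar>logistic_mean (snd v \<bullet> \<beta>)\<bar> \<le> 1 * 1"
        using elim logistic_mean_bounds[of "snd v \<bullet> \<beta>"] by (intro mult_mono) auto
      then show ?case by (simp add: abs_mult)
    qed
  qed measurable
  have "(\<integral>v. snd v $ k * fst v \<partial>D) = (\<integral>v. snd v $ k * real_cond_exp D F fst v \<partial>D)"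
    using real_cond_exp_intg(2)[OF i1 xF fst_m] by simp
  also have "\<dots> = (\<integral>v. snd v $ k * logistic_mean (snd v \<bullet> \<beta>) \<partial>D)"
  proof (rule integral_cong_AE)
    show "AE v in D. snd v $ k * real_cond_exp D F fst v = snd v $ k * logistic_mean (snd v \<bullet> \<beta>)"
      using model unfolding logistic_model_def F_def logistic_mean_def by eventually_elim simp
  qed measurable
  finally have "(\<integral>v. snd v $ k * fst v - snd v $ k * logistic_mean (snd v \<bullet> \<beta>) \<partial>D) = 0"
    using Bochner_Integration.integral_diff[OF i1 i2] by simp
  then show ?thesis by (simp add: algebra_simps)
qed

text \<open>
  The constant is the minimum of the quadratic form on the unit sphere.
\<close>

lemma positive_definite_lower_bound:
  fixes A :: "real ^ 'i ^ 'i::finite"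
  assumes "positive_definite A"
  obtains \<mu> where "0 < \<mu>" "\<And>u. \<mu> * (norm u)\<^sup>2 \<le> u \<bullet> (A *v u)"
proof -
  let ?q = "\<lambda>u. u \<bullet> (A *v u)"
  have "continuous_on (sphere 0 1) ?q"
    by (intro continuous_intros linear_continuous_on) (simp add: linear_conv_bounded_linear[symmetric])
  moreover have "compact (sphere (0 :: real ^ 'i) 1)" "sphere (0 :: real ^ 'i) 1 \<noteq> {}" by auto
  ultimately obtain w where w: "norm w = 1" "\<And>u. norm u = 1 \<Longrightarrow> ?q w \<le> ?q u"
    using continuous_attains_inf[of "sphere 0 1" ?q] by auto
  show thesis
  proof
    have "w \<noteq> 0" using w(1) by auto
    then show "0 < ?q w" using assms by (auto simp: positive_definite_def)
    show "?q w * (norm u)\<^sup>2 \<le> ?q u" for u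
    proof (cases "u = 0")
      case False
      have "?q w \<le> ?q (u /\<^sub>R norm u)" using False by (intro w(2)) simp
      also have "\<dots> = ?q u / (norm u)\<^sup>2"
        by (simp add: matrix_vector_mult_scaleR power2_eq_square field_simps)
      finally show ?thesis using False by (simp add: field_simps)
    qed simp
  qed
qed

text \<open>
  The exceptional set consists of a null set of badly coded observations, of the events that a coordinate
  of the score exceeds \<open>T * sqrt n\<close>, and of the events that an entry of the empirical information matrix
  deviates by more than \<open>n * \<tau>\<close> from its mean. The probability of the score events has a bound that
  does not depend on \<open>n\<close> and is made small by the choice of \<open>T\<close>; the others become exponentially unlikely. The order of
  the quantifiers matters: \<open>c\<close> and \<open>T\<close> are fixed before the radius \<open>C\<close>, so that the quadratic
  term can later be made to dominate.
\<close>

lemma log_likelihood_quadratic_drop: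
  fixes V :: "nat \<Rightarrow> 'a \<Rightarrow> real \<times> (real ^ 'i::finite)"
  assumes prob: "prob_space \<Omega>" and indep: "prob_space.indep_vars \<Omega> (\<lambda>_. borel) V UNIV"
    and distr: "\<And>i. distr \<Omega> borel (V i) = D"
    and y: "AE v in D. fst v \<in> {0, 1}" and x: "AE v in D. \<forall>k. \<bar>snd v $ k\<bar> \<le> 1"
    and model: "logistic_model D \<beta>0"
    and pd: "positive_definite (fisher_information D logistic_cumulant \<beta>0)"
  obtains c where "0 < c"
    "\<forall>\<epsilon>>0. \<exists>T. \<forall>C>0. \<exists>N. \<forall>n\<ge>N. \<exists>B\<in>sets \<Omega>. measure \<Omega> B < \<epsilon> \<and>
      (\<forall>\<omega>\<in>space \<Omega> - B. likelihood_drop n (\<lambda>i. V i \<omega>) \<beta>0 (C / sqrt (real n)) (c * C\<^sup>2 - T * C))"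
proof -
  interpret prob_space \<Omega> by fact
  have V [measurable]: "V i \<in> borel_measurable \<Omega>" for i
    using indep by (auto simp: indep_vars_def)
  have D: "prob_space D" "sets D = sets borel"
    using prob_space_distr[OF V[of 0]] distr[of 0] by auto
  define d where "d = real CARD('i)"
  have d: "0 < d" by (simp add: d_def)
  define A where "A = fisher_information D logistic_cumulant \<beta>0"
  obtain \<mu> where \<mu>: "0 < \<mu>" "\<And>u. \<mu> * (norm u)\<^sup>2 \<le> u \<bullet> (A *v u)"
    using positive_definite_lower_bound[OF pd[folded A_def]] by blast
  \<comment> \<open>An entrywise error of \<open>\<tau>\<close> changes the quadratic form on unit vectors
    by at most \<open>d\<^sup>2 * \<tau> = \<mu> / 2\<close>.\<close>
  define \<tau> where "\<tau> = \<mu> / (2 * d\<^sup>2)"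
  have \<tau>: "0 < \<tau>" "d\<^sup>2 * \<tau> \<le> \<mu> / 2" using \<mu>(1) d by (simp_all add: \<tau>_def)
  define score where "score = (\<lambda>k (v :: real \<times> (real ^ 'i)). (fst v - logistic_mean (snd v \<bullet> \<beta>0)) * snd v $ k)"
  define gram where "gram = (\<lambda>(k, l) (v :: real \<times> (real ^ 'i)). logistic_variance (snd v \<bullet> \<beta>0) * (snd v $ k * snd v $ l))"
  have [measurable]: "fst \<in> borel_measurable (borel :: (real \<times> (real ^ 'i)) measure)"
      "snd \<in> borel_measurable (borel :: (real \<times> (real ^ 'i)) measure)"
    by (auto intro!: borel_measurable_continuous_onI continuous_intros)
  have xk [measurable]: "(\<lambda>v. snd v $ k) \<in> borel_measurable (borel :: (real \<times> (real ^ 'i)) measure)" for k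
    by (auto intro!: borel_measurable_continuous_onI continuous_intros)
  have score_m [measurable]: "score k \<in> borel_measurable borel" for k
    unfolding score_def logistic_mean_def by measurable
  have gram_m [measurable]: "gram q \<in> borel_measurable borel" for q
    unfolding gram_def logistic_variance_def by (cases q) (simp, measurable)
  have score_bounds: "AE v in D. - 1 \<le> score k v \<and> score k v \<le> 1" for k
    using x y
  proof eventually_elim
    case (elim v)
    have "\<bar>fst v - logistic_mean (snd v \<bullet> \<beta>0)\<bar> * \<bar>snd v $ k\<bar> \<le> 1 * 1"
      using elim logistic_mean_bounds[of "snd v \<bullet> \<beta>0"] by (intro mult_mono) auto
    then show ?case by (simp add: score_def abs_mult[symmetric] abs_le_iff)
  qed
  have gram_bounds: "AE v in D. - 1 \<le> gram q v \<and> gram q v \<le> 1" for q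
    using x
  proof eventually_elim
    case (elim v)
    obtain k l where q: "q = (k, l)" by (cases q)
    have "\<bar>logistic_variance (snd v \<bullet> \<beta>0)\<bar> * (\<bar>snd v $ k\<bar> * \<bar>snd v $ l\<bar>) \<le> 1 * (1 * 1)"
      using elim logistic_variance_pos[of "snd v \<bullet> \<beta>0"] logistic_variance_le_1[of "snd v \<bullet> \<beta>0"]
      by (intro mult_mono) auto
    then show ?case by (simp add: q gram_def abs_mult[symmetric] abs_le_iff)
  qed
  have score_mean: "(\<integral>v. score k v \<partial>D) = 0" for k
    unfolding score_def using x by (intro logistic_score_mean_zero[OF D y _ model]) (auto elim: eventually_mono)
  have gram_mean: "(\<integral>v. gram (k, l) v \<partial>D) = A $ k $ l" for k l
    by (simp add: gram_def A_def fisher_information_def deriv2_logistic_cumulant)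
  have "AE \<omega> in \<Omega>. \<forall>i. fst (V i \<omega>) \<in> {0, 1} \<and> (\<forall>k. \<bar>snd (V i \<omega>) $ k\<bar> \<le> 1)"
  proof (subst AE_all_countable, rule allI)
    fix i
    have "AE v in distr \<Omega> borel (V i). fst v \<in> {0, 1} \<and> (\<forall>k. \<bar>snd v $ k\<bar> \<le> 1)"
      unfolding distr using x y by eventually_elim auto
    then show "AE \<omega> in \<Omega>. fst (V i \<omega>) \<in> {0, 1} \<and> (\<forall>k. \<bar>snd (V i \<omega>) $ k\<bar> \<le> 1)"
      by (rule AE_distrD[OF V])
  qed
  then obtain B0 where B0: "B0 \<in> null_sets \<Omega>"
    "\<And>\<omega> i. \<omega> \<in> space \<Omega> - B0 \<Longrightarrow> fst (V i \<omega>) \<in> {0, 1} \<and> (\<forall>k. \<bar>snd (V i \<omega>) $ k\<bar> \<le> 1)"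
    by (auto simp: eventually_ae_filter)
  show thesis
  proof (rule that[of "exp (- d) * \<mu> / 4"], goal_cases)
    case 1
    show ?case using \<mu>(1) by simp
  next
    case 2
    show ?case
    proof (intro allI impI)
      fix \<epsilon> :: real assume \<epsilon>: "0 < \<epsilon>"
      have "((\<lambda>T::real. d * (2 * exp (- 2 * T\<^sup>2 / 4))) \<longlongrightarrow> 0) at_top" by real_asymp
      then have "eventually (\<lambda>T. d * (2 * exp (- 2 * T\<^sup>2 / 4)) < \<epsilon> / 2 \<and> 0 \<le> T) at_top"
        using \<epsilon> by (intro eventually_conj order_tendstoD(2) eventually_ge_at_top) auto
      then obtain T where T: "d * (2 * exp (- 2 * T\<^sup>2 / 4)) < \<epsilon> / 2" "0 \<le> T"
        by (auto dest: eventually_happens)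
      show "\<exists>T. \<forall>C>0. \<exists>N. \<forall>n\<ge>N. \<exists>B\<in>sets \<Omega>. measure \<Omega> B < \<epsilon> \<and>
        (\<forall>\<omega>\<in>space \<Omega> - B. likelihood_drop n (\<lambda>i. V i \<omega>) \<beta>0 (C / sqrt (real n)) (exp (- d) * \<mu> / 4 * C\<^sup>2 - T * C))"
      \<comment> \<open>Up to here \<open>T\<close> bounds single coordinates of the score; along a direction, \<open>d\<close> of them add up.\<close>
      proof (intro exI[of _ "d * T"] allI impI)
        fix C :: real assume C: "0 < C"
        have "(\<lambda>n::nat. d\<^sup>2 * (2 * exp (- 2 * (real n * \<tau>\<^sup>2) / 4))) \<longlonglongrightarrow> 0"
          using \<tau>(1) by real_asymp
        then have "eventually (\<lambda>n::nat. d\<^sup>2 * (2 * exp (- 2 * (real n * \<tau>\<^sup>2) / 4)) < \<epsilon> / 2 \<and> n \<ge> max 1 (nat \<lceil>C\<^sup>2\<rceil>)) sequentially"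
          using \<epsilon> by (intro eventually_conj order_tendstoD(2) eventually_ge_at_top) auto
        then obtain N where N: "\<And>n. N \<le> n \<Longrightarrow> d\<^sup>2 * (2 * exp (- 2 * (real n * \<tau>\<^sup>2) / 4)) < \<epsilon> / 2 \<and> n \<ge> max 1 (nat \<lceil>C\<^sup>2\<rceil>)"
          by (auto simp: eventually_sequentially)
        show "\<exists>N. \<forall>n\<ge>N. \<exists>B\<in>sets \<Omega>. measure \<Omega> B < \<epsilon> \<and>
        (\<forall>\<omega>\<in>space \<Omega> - B. likelihood_drop n (\<lambda>i. V i \<omega>) \<beta>0 (C / sqrt (real n)) (exp (- d) * \<mu> / 4 * C\<^sup>2 - d * T * C))"
        proof (intro exI[of _ N] allI impI)
          fix n assume "N \<le> n"
          then have n: "d\<^sup>2 * (2 * exp (- 2 * (real n * \<tau>\<^sup>2) / 4)) < \<epsilon> / 2" "0 < n" "C\<^sup>2 \<le> real n"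
            using N[of n] real_nat_ceiling_ge[of "C\<^sup>2"] by (simp_all add: le_trans)
          have Cn: "C \<le> sqrt (real n)" using n(3) C by (simp add: real_le_rsqrt)
          define B1 where "B1 = (\<lambda>k. {\<omega> \<in> space \<Omega>. T * sqrt (real n) \<le> \<bar>(\<Sum>i<n. score k (V i \<omega>)) - real n * (\<integral>v. score k v \<partial>D)\<bar>})"
          define B2 where "B2 = (\<lambda>q. {\<omega> \<in> space \<Omega>. real n * \<tau> \<le> \<bar>(\<Sum>i<n. gram q (V i \<omega>)) - real n * (\<integral>v. gram q v \<partial>D)\<bar>})"
          have sets1: "B1 k \<in> sets \<Omega>" for k unfolding B1_def by measurable
          have sets2: "B2 q \<in> sets \<Omega>" for q unfolding B2_def by measurable
          have m1: "measure \<Omega> (B1 k) \<le> 2 * exp (- 2 * T\<^sup>2 / 4)" for k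
          proof -
            have "measure \<Omega> (B1 k) \<le> 2 * exp (- 2 * (T * sqrt (real n))\<^sup>2 / (real n * (1 - (- 1))\<^sup>2))"
              unfolding B1_def using n(2) T(2)
              by (intro iid_sum_concentration[OF prob indep distr score_m score_bounds]) auto
            also have "(T * sqrt (real n))\<^sup>2 = real n * T\<^sup>2" by (simp add: power_mult_distrib)
            finally show ?thesis using n(2) by simp
          qed
          have m2: "measure \<Omega> (B2 q) \<le> 2 * exp (- 2 * (real n * \<tau>\<^sup>2) / 4)" for q
          proof -
            have "measure \<Omega> (B2 q) \<le> 2 * exp (- 2 * (real n * \<tau>)\<^sup>2 / (real n * (1 - (- 1))\<^sup>2))"
              unfolding B2_def using n(2) \<tau>(1)
              by (intro iid_sum_concentration[OF prob indep distr gram_m gram_bounds]) auto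
            also have "(real n * \<tau>)\<^sup>2 = real n * (real n * \<tau>\<^sup>2)" by (simp add: power2_eq_square)
            finally show ?thesis using n(2) by simp
          qed
          define B where "B = B0 \<union> ((\<Union>k. B1 k) \<union> (\<Union>q. B2 q))"
          have B0s: "B0 \<in> sets \<Omega>" "measure \<Omega> B0 = 0" using B0(1) by (auto simp: measure_eq_0_null_sets)
          have s: "(\<Union>k. B1 k) \<in> sets \<Omega>" "(\<Union>q. B2 q) \<in> sets \<Omega>"
            using sets1 sets2 by (auto intro!: sets.finite_UN)
          have Bs: "B \<in> sets \<Omega>" unfolding B_def using s B0s by auto
          have "measure \<Omega> B \<le> measure \<Omega> B0 + (measure \<Omega> (\<Union>k. B1 k) + measure \<Omega> (\<Union>q. B2 q))"
            unfolding B_def using s B0s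
            by (intro order_trans[OF measure_Un_le] add_left_mono measure_Un_le) auto
          also have "measure \<Omega> (\<Union>k. B1 k) \<le> (\<Sum>k\<in>UNIV. measure \<Omega> (B1 k))"
            using sets1 by (intro measure_UNION_le) auto
          also have "\<dots> \<le> (\<Sum>k\<in>(UNIV :: 'i set). 2 * exp (- 2 * T\<^sup>2 / 4))" by (intro sum_mono m1)
          also have "\<dots> = d * (2 * exp (- 2 * T\<^sup>2 / 4))" by (simp add: d_def)
          also have "measure \<Omega> (\<Union>q. B2 q) \<le> (\<Sum>q\<in>UNIV. measure \<Omega> (B2 q))"
            using sets2 by (intro measure_UNION_le) auto
          also have "\<dots> \<le> (\<Sum>q\<in>(UNIV :: ('i \<times> 'i) set). 2 * exp (- 2 * (real n * \<tau>\<^sup>2) / 4))" by (intro sum_mono m2)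
          also have "\<dots> = d\<^sup>2 * (2 * exp (- 2 * (real n * \<tau>\<^sup>2) / 4))" by (simp add: d_def power2_eq_square)
          finally have Bm: "measure \<Omega> B < \<epsilon>" using T(1) n(1) B0s(2) by linarith
          have good: "likelihood_drop n (\<lambda>i. V i \<omega>) \<beta>0 (C / sqrt (real n)) (exp (- d) * \<mu> / 4 * C\<^sup>2 - d * T * C)"
            if \<omega>: "\<omega> \<in> space \<Omega> - B" for \<omega>
            unfolding likelihood_drop_def
          proof (intro conjI allI impI)
            have yx: "fst (V i \<omega>) \<in> {0, 1}" "\<bar>snd (V i \<omega>) $ k\<bar> \<le> 1" for i k
              using B0(2)[of \<omega> i] \<omega> by (auto simp: B_def)
            show "convex_on UNIV (\<lambda>\<beta>. - log_likelihood logistic_density n (\<lambda>i. V i \<omega>) \<beta>)"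
              using yx(1) by (intro convex_neg_log_likelihood) auto
            fix \<beta> assume \<beta>: "norm (\<beta> - \<beta>0) = C / sqrt (real n)"
            have "\<bar>\<Sum>i<n. score k (V i \<omega>)\<bar> \<le> T * sqrt (real n)" for k
              using \<omega> by (force simp: B_def B1_def score_mean not_le intro: less_imp_le)
            moreover have "\<bar>(\<Sum>i<n. gram (k, l) (V i \<omega>)) - real n * A $ k $ l\<bar> \<le> real n * \<tau>" for k l
            proof -
              have "\<omega> \<notin> B2 (k, l)" using \<omega> by (auto simp: B_def)
              then show ?thesis using \<omega> unfolding B2_def gram_mean by auto
            qed
            ultimately show "log_likelihood logistic_density n (\<lambda>i. V i \<omega>) \<beta> + (exp (- d) * \<mu> / 4 * C\<^sup>2 - d * T * C)
                \<le> log_likelihood logistic_density n (\<lambda>i. V i \<omega>) \<beta>0"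
              unfolding d_def
              by (intro log_likelihood_gap_on_sphere[where A = A and \<tau> = \<tau>])
                 (use yx \<mu> \<tau> n(2) C Cn \<beta> in \<open>auto simp: score_def gram_def d_def\<close>)
          qed
          show "\<exists>B\<in>sets \<Omega>. measure \<Omega> B < \<epsilon> \<and>
            (\<forall>\<omega>\<in>space \<Omega> - B. likelihood_drop n (\<lambda>i. V i \<omega>) \<beta>0 (C / sqrt (real n)) (exp (- d) * \<mu> / 4 * C\<^sup>2 - d * T * C))"
            using Bs Bm good by blast
        qed
      qed
    qed
  qed
qed

section \<open>Root-n consistency\<close>

lemma group_weight_le_max:
  assumes "j \<in> {1..J}"
  shows "lam1 * w1 j \<le> max_group_weight J lam1 w1"
  unfolding max_group_weight_def using assms by (intro Max_ge) auto

lemma fusion_weights_image: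
  "{lam0 * w0 j r s | j r s. j \<in> {1..J} \<and> r < s \<and> s \<le> p j} = (\<lambda>(j, r, s). lam0 * w0 j r s) ` fusion_pairs J p"
  by (force simp: fusion_pairs_def image_def)

lemma fusion_weight_le_max:
  assumes "j \<in> {1..J}" "r < s" "s \<le> p j"
  shows "lam0 * w0 j r s \<le> max_fusion_weight J p lam0 w0"
  unfolding max_fusion_weight_def fusion_weights_image
  using assms by (intro Max_ge finite_imageI finite_fusion_pairs) (force simp: fusion_pairs_def image_def)

lemma borel_measurable_max_group_weight:
  assumes "\<And>j. j \<in> {1..J} \<Longrightarrow> w1 j \<in> borel_measurable M"
  shows "(\<lambda>\<omega>. max_group_weight J lam1 (\<lambda>j. w1 j \<omega>)) \<in> borel_measurable M"
proof -
  have "{lam1 * w1 j \<omega> | j. j \<in> {1..J}} = (\<lambda>j. lam1 * w1 j \<omega>) ` {1..J}" for \<omega> by auto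
  then show ?thesis
    unfolding max_group_weight_def using assms
    by (simp only:) (intro borel_measurable_Max borel_measurable_times, auto)
qed

lemma borel_measurable_max_fusion_weight:
  assumes "\<And>j r s. j \<in> {1..J} \<Longrightarrow> r < s \<Longrightarrow> s \<le> p j \<Longrightarrow> w0 j r s \<in> borel_measurable M"
  shows "(\<lambda>\<omega>. max_fusion_weight J p lam0 (\<lambda>j r s. w0 j r s \<omega>)) \<in> borel_measurable M"
  unfolding max_fusion_weight_def fusion_weights_image split_beta using assms
  by (intro borel_measurable_Max borel_measurable_times finite_fusion_pairs) (auto simp: fusion_pairs_def)

theorem theorem3p3:
  fixes J :: nat and p :: "nat \<Rightarrow> nat" and ix :: "nat \<times> nat \<Rightarrow> 'd::finite"
    and \<Omega> :: "'a measure" and V :: "nat \<Rightarrow> 'a \<Rightarrow> real \<times> (real ^ 'd option)"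
    and D :: "(real \<times> (real ^ 'd option)) measure" and \<beta>star :: "real ^ 'd option"
    and lam1 lam0 :: "nat \<Rightarrow> real"
    and w1 :: "nat \<Rightarrow> nat \<Rightarrow> 'a \<Rightarrow> real" and w0 :: "nat \<Rightarrow> nat \<Rightarrow> nat \<Rightarrow> nat \<Rightarrow> 'a \<Rightarrow> real"
    and K :: real
  assumes J: "1 \<le> J" and p: "\<And>j. j \<in> {1..J} \<Longrightarrow> 1 \<le> p j"
    and ix: "bij_betw ix (dummy_index J p) (UNIV :: 'd set)"
    and prob: "prob_space \<Omega>"
    and indep: "prob_space.indep_vars \<Omega> (\<lambda>_. borel) V UNIV"
    and distr: "\<And>i. distr \<Omega> borel (V i) = D"
    and coding: "AE v in D. fst v \<in> {0, 1} \<and> snd v \<in> design_vectors J p ix"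
    and model: "logistic_model D \<beta>star"
    and Reg1: "Reg1 (logistic_density :: real \<times> (real ^ 'd option) \<Rightarrow> real ^ 'd option \<Rightarrow> real)
                 (\<lambda>_. 1) logistic_cumulant"
    and Reg2: "Reg2 D logistic_cumulant \<beta>star"
    and Reg3: "Reg3 D logistic_cumulant \<beta>star"
    and tuning: "\<And>n. 0 \<le> lam1 n" "\<And>n. 0 \<le> lam0 n"
    and w1_meas: "\<And>n j. j \<in> {1..J} \<Longrightarrow> w1 n j \<in> borel_measurable \<Omega>"
    and w1_pos: "\<And>n j \<omega>. j \<in> {1..J} \<Longrightarrow> \<omega> \<in> space \<Omega> \<Longrightarrow> 0 < w1 n j \<omega>"
    and w0_meas: "\<And>n j r s. j \<in> {1..J} \<Longrightarrow> r < s \<Longrightarrow> s \<le> p j \<Longrightarrow> w0 n j r s \<in> borel_measurable \<Omega>"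
    and w0_pos: "\<And>n j r s \<omega>. j \<in> {1..J} \<Longrightarrow> r < s \<Longrightarrow> s \<le> p j \<Longrightarrow> \<omega> \<in> space \<Omega> \<Longrightarrow> 0 < w0 n j r s \<omega>"
    and a1: "tendsto_in_prob \<Omega>
               (\<lambda>n \<omega>. max_group_weight J (lam1 n) (\<lambda>j. w1 n j \<omega>) / sqrt (real n)) 0"
    and a0: "tendsto_in_prob \<Omega>
               (\<lambda>n \<omega>. max_fusion_weight J p (lam0 n) (\<lambda>j r s. w0 n j r s \<omega>)) K"
  shows "\<exists>\<beta>hat :: nat \<Rightarrow> 'a \<Rightarrow> real ^ 'd option.
           (\<forall>n. \<beta>hat n \<in> borel_measurable \<Omega>) \<and>
           (\<lambda>n. measure \<Omega> {\<omega> \<in> space \<Omega>.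
              L0_FGL_estimator J p ix n (\<lambda>i. V i \<omega>) (lam1 n) (\<lambda>j. w1 n j \<omega>)
                (lam0 n) (\<lambda>j r s. w0 n j r s \<omega>) (\<beta>hat n \<omega>)}) \<longlonglongrightarrow> 1 \<and>
           bigO_in_prob \<Omega> (\<lambda>n \<omega>. norm (\<beta>hat n \<omega> - \<beta>star)) (\<lambda>n. 1 / sqrt (real n))"
proof -
  interpret prob_space \<Omega> by fact
  have V: "V i \<in> borel_measurable \<Omega>" for i
    using indep by (auto simp: indep_vars_def)
  define M where "M n \<omega> = M_pen J p ix n (\<lambda>i. V i \<omega>) (lam1 n) (\<lambda>j. w1 n j \<omega>) (lam0 n) (\<lambda>j r s. w0 n j r s \<omega>)" for n \<omega>
  define F where "F n P \<omega> = fused_criterion J p ix n (\<lambda>i. V i \<omega>) (lam1 n) (\<lambda>j. w1 n j \<omega>) (lam0 n) (\<lambda>j r s. w0 n j r s \<omega>) P" for n P \<omega>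
  have F_meas: "(\<lambda>\<omega>. F n P \<omega> \<beta>) \<in> borel_measurable \<Omega>" for n P \<beta>
    unfolding F_def by (rule borel_measurable_fused_criterion[OF V w1_meas w0_meas])
  have F_cont: "continuous_on UNIV (F n P \<omega>)" for n P \<omega>
    unfolding F_def by (rule continuous_fused_criterion)
  have M_le: "M n \<omega> \<beta> \<le> F n P \<omega> \<beta>" if "\<omega> \<in> space \<Omega>" "\<beta> \<in> fusion_subspace ix P" for n P \<omega> \<beta>
    unfolding M_def F_def
    by (rule M_pen_le_fused_criterion[OF tuning(2) less_imp_le[OF w0_pos] that(2)]) (use that(1) in auto)
  have M_att: "\<exists>P\<in>Pow (fusion_pairs J p). \<beta> \<in> fusion_subspace ix P \<and> M n \<omega> \<beta> = F n P \<omega> \<beta>" for n \<omega> \<beta>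
    unfolding M_def F_def by (rule M_pen_eq_fused_criterion)
  have M_meas: "(\<lambda>\<omega>. M n \<omega> (b \<omega>)) \<in> borel_measurable \<Omega>" if "b \<in> borel_measurable \<Omega>" for n b
    unfolding M_def by (rule borel_measurable_M_pen[OF V that w1_meas w0_meas])
  have patterns: "finite (Pow (fusion_pairs J p))" using finite_fusion_pairs by blast
  have "\<exists>b. b \<in> borel_measurable \<Omega> \<and>
      (\<forall>\<omega>\<in>space \<Omega>. \<forall>\<beta>\<in>cball \<beta>star 1. M n \<omega> (b \<omega>) \<le> M n \<omega> \<beta>)" for n
  proof -
    have "compact (cball \<beta>star 1)" "cball \<beta>star 1 \<noteq> {}" by simp_all
    from measurable_piecewise_minimizer[where S = "fusion_subspace ix" and f = "F n" and F = "M n" and M = \<Omega>,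
        OF patterns closed_fusion_subspace this F_meas F_cont M_le M_att M_meas]
    obtain b where "b \<in> borel_measurable \<Omega>"
      "\<And>\<omega>. \<omega> \<in> space \<Omega> \<Longrightarrow> b \<omega> \<in> cball \<beta>star 1 \<and> (\<forall>\<beta>\<in>cball \<beta>star 1. M n \<omega> (b \<omega>) \<le> M n \<omega> \<beta>)"
      by blast
    then show ?thesis by blast
  qed
  then obtain b where b_ex: "\<forall>n. b n \<in> borel_measurable \<Omega> \<and>
      (\<forall>\<omega>\<in>space \<Omega>. \<forall>\<beta>\<in>cball \<beta>star 1. M n \<omega> (b n \<omega>) \<le> M n \<omega> \<beta>)"
    using choice[of "\<lambda>n b. b \<in> borel_measurable \<Omega> \<and>
      (\<forall>\<omega>\<in>space \<Omega>. \<forall>\<beta>\<in>cball \<beta>star 1. M n \<omega> (b \<omega>) \<le> M n \<omega> \<beta>)"] by blast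
  have b: "b n \<in> borel_measurable \<Omega>"
      "\<And>\<omega> \<beta>. \<omega> \<in> space \<Omega> \<Longrightarrow> \<beta> \<in> cball \<beta>star 1 \<Longrightarrow> M n \<omega> (b n \<omega>) \<le> M n \<omega> \<beta>" for n
    using b_ex by blast+
  define E where "E n = {\<omega> \<in> space \<Omega>. \<forall>\<beta>. M n \<omega> (b n \<omega>) \<le> M n \<omega> \<beta>}" for n
  have E_sets: "E n \<in> sets \<Omega>" for n
    unfolding E_def
    by (rule sets_global_minimizer[where S = "fusion_subspace ix" and f = "F n" and F = "M n",
          OF patterns F_meas F_cont M_le M_att M_meas[OF b(1)]])
  have y: "AE v in D. fst v \<in> {0, 1}" using coding by eventually_elim blast
  have x: "AE v in D. \<forall>k. \<bar>snd v $ k\<bar> \<le> 1"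
    using coding
  proof eventually_elim
    case (elim v)
    then obtain l where none: "snd v $ None = 1" and l: "\<forall>j\<in>{1..J}. l j \<le> p j \<and>
        (\<forall>k\<in>{1..p j}. snd v $ Some (ix (j, k)) = of_bool (l j = k))"
      unfolding design_vectors_def by blast
    have "\<bar>snd v $ k\<bar> \<le> 1" for k
    proof (cases k)
      case None
      then show ?thesis using none by simp
    next
      case (Some i)
      have "i \<in> ix ` dummy_index J p" using bij_betw_imp_surj_on[OF ix] by blast
      then obtain j m where jm: "j \<in> {1..J}" "m \<in> {1..p j}" "i = ix (j, m)"
        unfolding dummy_index_def by blast
      then have "snd v $ k = of_bool (l j = m)" using l Some by blast
      then show ?thesis by simp
    qed
    then show ?case by blast
  qed
  have pd: "positive_definite (fisher_information D logistic_cumulant \<beta>star)"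
    using Reg2 by (simp add: Reg2_def)
  obtain c where c: "0 < c"
    and drop: "\<forall>\<epsilon>>0. \<exists>T. \<forall>C>0. \<exists>N. \<forall>n\<ge>N. \<exists>B\<in>sets \<Omega>. measure \<Omega> B < \<epsilon> \<and>
      (\<forall>\<omega>\<in>space \<Omega> - B. likelihood_drop n (\<lambda>i. V i \<omega>) \<beta>star (C / sqrt (real n)) (c * C\<^sup>2 - T * C))"
    by (rule log_likelihood_quadratic_drop[OF prob indep distr y x model pd])
  define G where "G n \<omega> = max_group_weight J (lam1 n) (\<lambda>j. w1 n j \<omega>)" for n \<omega>
  define H where "H n \<omega> = max_fusion_weight J p (lam0 n) (\<lambda>j r s. w0 n j r s \<omega>)" for n \<omega>
  have G_meas [measurable]: "G n \<in> borel_measurable \<Omega>" for n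
    unfolding G_def[abs_def] by (rule borel_measurable_max_group_weight[OF w1_meas])
  have H_meas [measurable]: "H n \<in> borel_measurable \<Omega>" for n
    unfolding H_def[abs_def] by (rule borel_measurable_max_fusion_weight[OF w0_meas])
  have key: "\<exists>C>0. \<exists>N. \<forall>n\<ge>N. \<exists>B\<in>sets \<Omega>. measure \<Omega> B < \<epsilon> \<and>
      (\<forall>\<omega>\<in>space \<Omega> - B. \<omega> \<in> E n \<and> norm (b n \<omega> - \<beta>star) \<le> C / sqrt (real n))" if \<epsilon>: "0 < \<epsilon>" for \<epsilon>
  proof -
    obtain T where T: "\<forall>C>0. \<exists>N. \<forall>n\<ge>N. \<exists>B\<in>sets \<Omega>. measure \<Omega> B < \<epsilon> / 3 \<and>
      (\<forall>\<omega>\<in>space \<Omega> - B. likelihood_drop n (\<lambda>i. V i \<omega>) \<beta>star (C / sqrt (real n)) (c * C\<^sup>2 - T * C))"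
      using drop[rule_format, of "\<epsilon> / 3"] \<epsilon> by auto
    \<comment> \<open>The bound for the \<open>L\<^sub>0\<close> penalty at the true parameter, valid as soon as the largest fusion weight
      is within 1 of its limit \<open>K\<close>.\<close>
    let ?m = "real (card (fusion_pairs J p)) * (\<bar>K\<bar> + 1)"
    have "filterlim (\<lambda>C. c * C\<^sup>2 - T * C - real J * C) at_top at_top"
      using c by real_asymp
    then have "eventually (\<lambda>C. ?m < c * C\<^sup>2 - T * C - real J * C \<and> 0 < C) at_top"
      by (intro eventually_conj eventually_gt_at_top) (simp add: filterlim_at_top_dense)
    then obtain C where C: "?m < c * C\<^sup>2 - T * C - real J * C" "0 < C"
      by (auto dest: eventually_happens)
    obtain N1 where N1: "\<And>n. N1 \<le> n \<Longrightarrow> \<exists>B\<in>sets \<Omega>. measure \<Omega> B < \<epsilon> / 3 \<and>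
      (\<forall>\<omega>\<in>space \<Omega> - B. likelihood_drop n (\<lambda>i. V i \<omega>) \<beta>star (C / sqrt (real n)) (c * C\<^sup>2 - T * C))"
      using T C(2) by blast
    \<comment> \<open>The group weights may exceed any fixed multiple of \<open>sqrt n\<close> only with vanishing probability;
      the threshold 1 suffices because \<open>C\<close> was chosen to absorb \<open>J * C\<close>.\<close>
    define B1 where "B1 n = {\<omega> \<in> space \<Omega>. \<bar>G n \<omega> / sqrt (real n) - 0\<bar> > 1}" for n
    define B2 where "B2 n = {\<omega> \<in> space \<Omega>. \<bar>H n \<omega> - K\<bar> > 1}" for n
    have "(\<lambda>n. measure \<Omega> (B1 n)) \<longlonglongrightarrow> 0" "(\<lambda>n. measure \<Omega> (B2 n)) \<longlonglongrightarrow> 0"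
      using a1 a0 unfolding tendsto_in_prob_def B1_def B2_def G_def H_def
      by (meson zero_less_one)+
    then have "eventually (\<lambda>n. measure \<Omega> (B1 n) < \<epsilon> / 3 \<and> measure \<Omega> (B2 n) < \<epsilon> / 3 \<and>
        max 1 (nat \<lceil>C\<^sup>2\<rceil>) \<le> n) sequentially"
      using \<epsilon> by (intro eventually_conj order_tendstoD(2) eventually_ge_at_top) auto
    then obtain N2 where N2: "\<And>n. N2 \<le> n \<Longrightarrow> measure \<Omega> (B1 n) < \<epsilon> / 3 \<and> measure \<Omega> (B2 n) < \<epsilon> / 3 \<and>
        max 1 (nat \<lceil>C\<^sup>2\<rceil>) \<le> n"
      by (auto simp: eventually_sequentially)
    have "\<exists>B\<in>sets \<Omega>. measure \<Omega> B < \<epsilon> \<and>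
        (\<forall>\<omega>\<in>space \<Omega> - B. \<omega> \<in> E n \<and> norm (b n \<omega> - \<beta>star) \<le> C / sqrt (real n))"
      if n: "max N1 N2 \<le> n" for n
    proof -
      obtain B0 where B0: "B0 \<in> sets \<Omega>" "measure \<Omega> B0 < \<epsilon> / 3"
        and lik: "\<forall>\<omega>\<in>space \<Omega> - B0. likelihood_drop n (\<lambda>i. V i \<omega>) \<beta>star (C / sqrt (real n)) (c * C\<^sup>2 - T * C)"
        using N1[of n] n by auto
      have n': "measure \<Omega> (B1 n) < \<epsilon> / 3" "measure \<Omega> (B2 n) < \<epsilon> / 3" "0 < n" "C\<^sup>2 \<le> real n"
        using N2[of n] n real_nat_ceiling_ge[of "C\<^sup>2"] by (simp_all add: le_trans)
      define R where "R = C / sqrt (real n)"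
      have "C \<le> sqrt (real n)" using n'(4) C(2) by (simp add: real_le_rsqrt)
      then have R: "0 < R" "R \<le> 1" using C(2) n'(3) by (simp_all add: R_def)
      have s: "B1 n \<in> sets \<Omega>" "B2 n \<in> sets \<Omega>" unfolding B1_def B2_def by measurable
      define B where "B = B0 \<union> (B1 n \<union> B2 n)"
      have "measure \<Omega> B \<le> measure \<Omega> B0 + (measure \<Omega> (B1 n) + measure \<Omega> (B2 n))"
        unfolding B_def using s B0
        by (intro order_trans[OF measure_Un_le] add_left_mono measure_Un_le) auto
      then have "measure \<Omega> B < \<epsilon>" using B0 n' by linarith
      moreover have "B \<in> sets \<Omega>" unfolding B_def using s B0 by auto
      moreover have "\<omega> \<in> E n \<and> norm (b n \<omega> - \<beta>star) \<le> C / sqrt (real n)" if "\<omega> \<in> space \<Omega> - B" for \<omega>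
      proof -
        from that have \<omega>: "\<omega> \<in> space \<Omega>" "\<omega> \<in> space \<Omega> - B0" "\<omega> \<notin> B1 n" "\<omega> \<notin> B2 n"
          by (auto simp: B_def)
        have Gle: "G n \<omega> \<le> sqrt (real n)"
          using \<omega>(1,3) n'(3) by (auto simp: B1_def abs_le_iff not_less field_simps)
        have Hle: "H n \<omega> \<le> \<bar>K\<bar> + 1"
          using \<omega>(1,4) by (auto simp: B2_def)
        \<comment> \<open>Points outside the unit ball are covered too, as \<open>R \<le> 1\<close>; this turns the constrained minimizer
          into a global one.\<close>
        have sep: "M n \<omega> \<beta>star < M n \<omega> \<beta>" if "R \<le> norm (\<beta> - \<beta>star)" for \<beta>
          unfolding M_def
        proof (rule M_pen_separation[where \<kappa> = "sqrt (real n)" and \<nu> = "\<bar>K\<bar> + 1" and R = R and \<gamma> = "c * C\<^sup>2 - T * C"])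
          show "inj_on ix (dummy_index J p)" using ix by (rule bij_betw_imp_inj_on)
          show "lam1 n * w1 n j \<omega> \<le> sqrt (real n)" if "j \<in> {1..J}" for j
            using group_weight_le_max[OF that, of "lam1 n" "\<lambda>j. w1 n j \<omega>"] Gle by (simp add: G_def)
          show "lam0 n * w0 n j r s \<omega> \<le> \<bar>K\<bar> + 1" if "j \<in> {1..J}" "r < s" "s \<le> p j" for j r s
            using fusion_weight_le_max[of j J r s p "lam0 n" "\<lambda>j r s. w0 n j r s \<omega>"] that Hle by (simp add: H_def)
          have "sqrt (real n) * R = C" using n'(3) by (simp add: R_def)
          then have "real J * sqrt (real n) * R = real J * C" by (simp add: mult.assoc)
          then show "real J * sqrt (real n) * R + ?m < c * C\<^sup>2 - T * C" using C(1) by linarith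
          show "R \<le> norm (\<beta> - \<beta>star)" by fact
          show "likelihood_drop n (\<lambda>i. V i \<omega>) \<beta>star R (c * C\<^sup>2 - T * C)"
            using lik \<omega>(2) by (simp add: R_def)
        qed (use tuning w0_pos w1_pos \<omega>(1) R in \<open>auto intro: less_imp_le\<close>)
        have bstar: "M n \<omega> (b n \<omega>) \<le> M n \<omega> \<beta>star" using b(2)[OF \<omega>(1)] by simp
        have "norm (b n \<omega> - \<beta>star) \<le> R" using sep[of "b n \<omega>"] bstar by linarith
        moreover have "M n \<omega> (b n \<omega>) \<le> M n \<omega> \<beta>" for \<beta>
        proof (cases "\<beta> \<in> cball \<beta>star 1")
          case True
          then show ?thesis by (rule b(2)[OF \<omega>(1)])
        next
          case False
          then have "R \<le> norm (\<beta> - \<beta>star)" using R(2) by (simp add: dist_norm norm_minus_commute)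
          then show ?thesis using sep[of \<beta>] bstar by linarith
        qed
        ultimately show ?thesis using \<omega>(1) by (simp add: E_def R_def)
      qed
      ultimately show ?thesis by blast
    qed
    then show ?thesis using C(2) by blast
  qed
  show ?thesis
  proof (intro exI[of _ b] conjI allI)
    show "b n \<in> borel_measurable \<Omega>" for n by (rule b(1))
    have argmin_set: "{\<omega> \<in> space \<Omega>. L0_FGL_estimator J p ix n (\<lambda>i. V i \<omega>) (lam1 n) (\<lambda>j. w1 n j \<omega>)
                (lam0 n) (\<lambda>j r s. w0 n j r s \<omega>) (b n \<omega>)} = E n" for n
      unfolding E_def L0_FGL_estimator_def is_arg_min_def M_def by (intro Collect_cong) (simp only: not_ex not_less simp_thms)
    have lim_1: "(\<lambda>n. measure \<Omega> (E n)) \<longlonglongrightarrow> 1"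
    proof (rule LIMSEQ_I)
      fix r :: real assume "0 < r"
      from key[OF this] obtain C N where N: "\<forall>n\<ge>N. \<exists>B\<in>sets \<Omega>. measure \<Omega> B < r \<and>
        (\<forall>\<omega>\<in>space \<Omega> - B. \<omega> \<in> E n \<and> norm (b n \<omega> - \<beta>star) \<le> C / sqrt (real n))" by blast
      have "norm (measure \<Omega> (E n) - 1) < r" if "N \<le> n" for n
      proof -
        obtain B where B: "B \<in> sets \<Omega>" "measure \<Omega> B < r" "space \<Omega> - B \<subseteq> E n"
          using N[rule_format, OF \<open>N \<le> n\<close>] by blast
        have "1 - measure \<Omega> B = measure \<Omega> (space \<Omega> - B)" using prob_compl[OF B(1)] by simp
        also have "\<dots> \<le> measure \<Omega> (E n)" using B(3) E_sets by (intro finite_measure_mono)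
        finally show ?thesis using B(2) prob_le_1[of "E n"] by simp
      qed
      then show "\<exists>N. \<forall>n\<ge>N. norm (measure \<Omega> (E n) - 1) < r" by blast
    qed
    show "(\<lambda>n. measure \<Omega> {\<omega> \<in> space \<Omega>.
              L0_FGL_estimator J p ix n (\<lambda>i. V i \<omega>) (lam1 n) (\<lambda>j. w1 n j \<omega>)
                (lam0 n) (\<lambda>j r s. w0 n j r s \<omega>) (b n \<omega>)}) \<longlonglongrightarrow> 1"
      unfolding argmin_set by (rule lim_1)
    show "bigO_in_prob \<Omega> (\<lambda>n \<omega>. norm (b n \<omega> - \<beta>star)) (\<lambda>n. 1 / sqrt (real n))"
      unfolding bigO_in_prob_def
    proof (intro allI impI)
      fix \<epsilon> :: real assume "0 < \<epsilon>"
      from key[OF this] obtain C N where C: "0 < C" and N: "\<forall>n\<ge>N. \<exists>B\<in>sets \<Omega>. measure \<Omega> B < \<epsilon> \<and>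
        (\<forall>\<omega>\<in>space \<Omega> - B. \<omega> \<in> E n \<and> norm (b n \<omega> - \<beta>star) \<le> C / sqrt (real n))" by blast
      have "measure \<Omega> {\<omega> \<in> space \<Omega>. \<bar>norm (b n \<omega> - \<beta>star)\<bar> > C * (1 / sqrt (real n))} < \<epsilon>" if "N \<le> n" for n
      proof -
        obtain B where B: "B \<in> sets \<Omega>" "measure \<Omega> B < \<epsilon>"
          "\<And>\<omega>. \<omega> \<in> space \<Omega> - B \<Longrightarrow> norm (b n \<omega> - \<beta>star) \<le> C / sqrt (real n)"
          using N[rule_format, OF \<open>N \<le> n\<close>] by blast
        have "measure \<Omega> {\<omega> \<in> space \<Omega>. \<bar>norm (b n \<omega> - \<beta>star)\<bar> > C * (1 / sqrt (real n))} \<le> measure \<Omega> B"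
        proof (intro finite_measure_mono B(1) subsetI)
          fix \<omega> assume "\<omega> \<in> {\<omega> \<in> space \<Omega>. \<bar>norm (b n \<omega> - \<beta>star)\<bar> > C * (1 / sqrt (real n))}"
          then show "\<omega> \<in> B" using B(3)[of \<omega>] by (cases "\<omega> \<in> B") auto
        qed
        with B(2) show ?thesis by linarith
      qed
      with C show "\<exists>C>0. \<exists>N. \<forall>n\<ge>N. measure \<Omega> {\<omega> \<in> space \<Omega>. \<bar>norm (b n \<omega> - \<beta>star)\<bar> > C * (1 / sqrt (real n))} < \<epsilon>"
        by blast
    qed
  qed
qed

end
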